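(* Let $X\subseteq\mathbb{P}^n$ be a hypersurface of degree $d\ge2$ admitting an induced additive action, let $(A,U)$ be the corresponding $H$-pair with maximal ideal $\mathfrak{m}$, and let $X_0\subseteq\mathbb{P}(\mathfrak{m})\cong\mathbb{P}^{n-1}$ be the boundary of $X$, i.e. the complement in $X$ to the open $\mathbb{G}_a^{n-1}$-orbit. Then $X_0$ is a degenerate projective hypersurface in $\mathbb{P}(\mathfrak{m})$. In particular, $X_0$ is either singular or a hyperplane in $\mathbb{P}(\mathfrak{m})$.
   Context: The base field $\mathbb{K}$ is algebraically closed of characteristic zero; all varieties are over $\mathbb{K}$ (reduced; the hypersurface $X_0$ may be reducible); $\mathbb{G}_a^m=(\mathbb{K}^m,+)$. An additive action on an (irreducible) variety $X$ is an effective regular action of $\mathbb{G}_a^m$ on $X$ with an open orbit. An additive action $\mathbb{G}_a^{n-1}\times X\to X$ on a projective hypersurface $X\subseteq\mathbb{P}^n$ is called induced if it extends to a regular action of $\mathbb{G}_a^{n-1}$ on $\mathbb{P}^n$. All algebras are commutative, associative and unital. An $H$-pair is a pair $(A,U)$, where $A$ is a local finite-dimensional $\mathbb{K}$-algebra with maximal ideal $\mathfrak{m}$ (so $A=\mathbb{K}\oplus\mathfrak{m}$) and $U\subseteq\mathfrak{m}$ is a hyperplane generating $A$ as a unital algebra. It is known (generalized Hassett–Tschinkel correspondence) that induced additive actions on hypersurfaces in $\mathbb{P}^n$ other than hyperplanes correspond bijectively, up to equivalence, to $H$-pairs $(A,U)$ with $\dim A=n+1$: identifying $\mathbb{P}^n$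 with $\mathbb{P}(A)$ by a suitable linear isomorphism and denoting by $p\colon A\setminus\{0\}\to\mathbb{P}(A)$ the canonical projection, $X=p(\overline{\mathbb{K}^\times\exp U})$, and $\mathbb{G}_a^{n-1}\cong\exp U$ acts by multiplication. It is known that the degree $d$ of $X$ is the greatest integer with $\mathfrak{m}^d\nsubseteq U$, and that $X_0=X\cap\mathbb{P}(\mathfrak{m})=p(\{z\in\mathfrak{m}\setminus\{0\}\mid z^d\in U\})$, a hypersurface in $\mathbb{P}(\mathfrak{m})$. A hypersurface in $\mathbb{P}^N$ given by a homogeneous equation $g(z_0,\ldots,z_N)=0$ is called non-degenerate if there is no linear change of variables after which $g$ depends on fewer than $N+1$ variables (equivalently, the hypersurface is not a projective cone over a hypersurface in a projective subspace $\mathbb{P}^k\subseteq\mathbb{P}^N$ with $k<N$); otherwise it is degenerate. *)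

theory Defs
  imports
    "HOL-Analysis.Cartesian_Space"
    "HOL-Library.Poly_Mapping"
    "HOL-Computational_Algebra.Polynomial"
begin

section \<open>Multivariate polynomials\<close>

text \<open>A polynomial in variables indexed by \<open>'i\<close> is a finitely supported function from exponent
  vectors to coefficients; ring operations are those of \<^theory>\<open>HOL-Library.Poly_Mapping\<close>.\<close>

type_synonym ('i, 'k) mpoly = "('i \<Rightarrow>\<^sub>0 nat) \<Rightarrow>\<^sub>0 'k"

definition peval :: "('i \<Rightarrow> 'k::comm_semiring_1) \<Rightarrow> ('i, 'k) mpoly \<Rightarrow> 'k" where
  "peval x f = (\<Sum>\<mu>\<in>Poly_Mapping.keys f.
     Poly_Mapping.lookup f \<mu> * (\<Prod>i\<in>Poly_Mapping.keys \<mu>. x i ^ Poly_Mapping.lookup \<mu> i))"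

definition pvars :: "('i, 'k::zero) mpoly \<Rightarrow> 'i set" where
  "pvars f = (\<Union>\<mu>\<in>Poly_Mapping.keys f. Poly_Mapping.keys \<mu>)"

definition homogeneous_in :: "'i set \<Rightarrow> nat \<Rightarrow> ('i, 'k::zero) mpoly \<Rightarrow> bool" where
  "homogeneous_in V d f \<longleftrightarrow>
     (\<forall>\<mu>\<in>Poly_Mapping.keys f. (\<Sum>i\<in>Poly_Mapping.keys \<mu> \<inter> V. Poly_Mapping.lookup \<mu> i) = d)"

abbreviation homogeneous :: "nat \<Rightarrow> ('i, 'k::zero) mpoly \<Rightarrow> bool" where
  "homogeneous \<equiv> homogeneous_in UNIV"

definition pderiv_in :: "'i \<Rightarrow> ('i, 'k::comm_semiring_1) mpoly \<Rightarrow> ('i, 'k) mpoly" where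
  "pderiv_in i f = (\<Sum>\<mu>\<in>Poly_Mapping.keys f.
     Poly_Mapping.single (\<mu> - Poly_Mapping.single i 1)
       (of_nat (Poly_Mapping.lookup \<mu> i) * Poly_Mapping.lookup f \<mu>))"


section \<open>Projective space and its Zariski topology\<close>

text \<open>Points of the projective space of a vector space with scalar multiplication \<open>s\<close> are lines
  through the origin, as sets of vectors. Hence an injective linear map \<open>f\<close> acts on points by
  \<open>L \<mapsto> f ` L\<close>.\<close>

definition line :: "('k \<Rightarrow> 'v \<Rightarrow> 'v) \<Rightarrow> 'v \<Rightarrow> 'v set" where
  "line s v = range (\<lambda>c. s c v)"

definition proj_space :: "('k \<Rightarrow> 'v::zero \<Rightarrow> 'v) \<Rightarrow> 'v set \<Rightarrow> 'v set set" where
  "proj_space s W = line s ` (W - {0})"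

text \<open>The type \<open>'k ^ 'n\<close> with \<open>CARD('n) = N + 1\<close> carries the standard projective \<open>N\<close>-space.\<close>

definition pt :: "'k::field ^ 'n \<Rightarrow> ('k ^ 'n) set" where
  "pt x = line (*s) x"

definition projective_space :: "('k::field ^ 'n) set set" where
  "projective_space = proj_space (*s) UNIV"

definition zero_locus :: "('n, 'k::field) mpoly set \<Rightarrow> ('k ^ 'n) set set" where
  "zero_locus S = {pt x |x. x \<noteq> 0 \<and> (\<forall>f\<in>S. peval (($) x) f = 0)}"

definition zariski_closed :: "('k::field ^ 'n) set set \<Rightarrow> bool" where
  "zariski_closed X \<longleftrightarrow> (\<exists>S. (\<forall>f\<in>S. \<exists>d. homogeneous d f) \<and> X = zero_locus S)"

definition irreducible_closed :: "('k::field ^ 'n) set set \<Rightarrow> bool" where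
  "irreducible_closed X \<longleftrightarrow> zariski_closed X \<and> X \<noteq> {} \<and>
     (\<forall>Y Z. zariski_closed Y \<and> zariski_closed Z \<and> X = Y \<union> Z \<longrightarrow> X = Y \<or> X = Z)"

definition vanishing_ideal :: "('k::field ^ 'n) set set \<Rightarrow> ('n, 'k) mpoly set" where
  "vanishing_ideal X = {f. \<forall>x. x \<noteq> 0 \<and> pt x \<in> X \<longrightarrow> peval (($) x) f = 0}"

definition affine_closure :: "('k::field ^ 'n) set \<Rightarrow> ('k ^ 'n) set" where
  "affine_closure S = {x. \<forall>f. (\<forall>y\<in>S. peval (($) y) f = 0) \<longrightarrow> peval (($) x) f = 0}"


section \<open>Hypersurfaces\<close>

definition hypersurface_eq :: "('n, 'k::field) mpoly \<Rightarrow> ('k ^ 'n) set set \<Rightarrow> bool" where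
  "hypersurface_eq g X \<longleftrightarrow> g \<noteq> 0 \<and> (\<exists>d>0. homogeneous d g) \<and> X = zero_locus {g}"

definition hypersurface :: "('k::field ^ 'n) set set \<Rightarrow> bool" where
  "hypersurface X \<longleftrightarrow> (\<exists>g. hypersurface_eq g X)"

text \<open>The degree is that of a reduced equation, i.e. of a generator of the vanishing ideal.\<close>

definition hypersurface_of_degree :: "nat \<Rightarrow> ('k::field ^ 'n) set set \<Rightarrow> bool" where
  "hypersurface_of_degree d X \<longleftrightarrow>
     (\<exists>g. hypersurface_eq g X \<and> homogeneous d g \<and> vanishing_ideal X = range (\<lambda>h. g * h))"

definition hyperplane :: "('k::field ^ 'n) set set \<Rightarrow> bool" where
  "hyperplane X \<longleftrightarrow> (\<exists>g. g \<noteq> 0 \<and> homogeneous 1 g \<and> X = zero_locus {g})"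

text \<open>Over an infinite field the equality of polynomial functions below is the equality of the
  polynomials \<open>g(Mz)\<close> and \<open>h(z)\<close>.\<close>

definition depends_on_fewer_variables :: "('n::finite, 'k::field) mpoly \<Rightarrow> bool" where
  "depends_on_fewer_variables g \<longleftrightarrow>
     (\<exists>(M :: 'k ^ 'n ^ 'n) h. invertible M \<and>
        (\<forall>x. peval (($) (M *v x)) g = peval (($) x) h) \<and> card (pvars h) < CARD('n))"

text \<open>Over an algebraically closed field, whether an equation can be written in fewer variables
  depends only on its zero locus; in particular it does not matter that \<open>g\<close> is not required to
  be reduced. The universal quantifier makes the notion cover every equation, including the
  reduced one.\<close>

definition degenerate_hypersurface :: "('k::field ^ 'n::finite) set set \<Rightarrow> bool" where
  "degenerate_hypersurface X \<longleftrightarrow>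
     hypersurface X \<and> (\<forall>g. hypersurface_eq g X \<longrightarrow> depends_on_fewer_variables g)"

text \<open>Jacobian criterion in codimension one, for \<open>X\<close> with its reduced structure: at a singular
  point all elements of the vanishing ideal (not merely of a chosen, possibly non-reduced,
  equation) have zero differential.\<close>

definition singular_hypersurface :: "('k::field ^ 'n) set set \<Rightarrow> bool" where
  "singular_hypersurface X \<longleftrightarrow> hypersurface X \<and>
     (\<exists>x. x \<noteq> 0 \<and> pt x \<in> X \<and>
        (\<forall>f\<in>vanishing_ideal X. \<forall>i. peval (($) x) (pderiv_in i f) = 0))"


section \<open>Additive actions\<close>

text \<open>The vector group is \<open>'k ^ 'g\<close> under addition. A map from its product with \<open>X\<close> to projective
  space is regular if near each point it is given by polynomials that are homogeneous of a common
  degree in the projective coordinates (the variables in \<open>range Inr\<close>).\<close>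

definition regular_map_on ::
  "('k::field ^ 'n) set set \<Rightarrow> ('k ^ 'g \<Rightarrow> ('k ^ 'n) set \<Rightarrow> ('k ^ 'n) set) \<Rightarrow> bool" where
  "regular_map_on X \<alpha> \<longleftrightarrow>
     (\<forall>s x. x \<noteq> 0 \<and> pt x \<in> X \<longrightarrow>
       (\<exists>(F :: 'n \<Rightarrow> ('g + 'n, 'k) mpoly) e.
          (\<forall>i. homogeneous_in (range Inr) e (F i)) \<and>
          (\<exists>i. peval (case_sum (($) s) (($) x)) (F i) \<noteq> 0) \<and>
          (\<forall>t y. y \<noteq> 0 \<and> pt y \<in> X \<and> (\<exists>i. peval (case_sum (($) t) (($) y)) (F i) \<noteq> 0) \<longrightarrow>
             \<alpha> t (pt y) = pt (\<chi> i. peval (case_sum (($) t) (($) y)) (F i)))))"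

definition regular_action ::
  "('k::field ^ 'n) set set \<Rightarrow> ('k ^ 'g \<Rightarrow> ('k ^ 'n) set \<Rightarrow> ('k ^ 'n) set) \<Rightarrow> bool" where
  "regular_action X \<alpha> \<longleftrightarrow> regular_map_on X \<alpha> \<and>
     (\<forall>s. \<forall>L\<in>X. \<alpha> s L \<in> X) \<and>
     (\<forall>L\<in>X. \<alpha> 0 L = L) \<and>
     (\<forall>s t. \<forall>L\<in>X. \<alpha> (s + t) L = \<alpha> s (\<alpha> t L))"

definition effective_action ::
  "('k::field ^ 'n) set set \<Rightarrow> ('k ^ 'g \<Rightarrow> ('k ^ 'n) set \<Rightarrow> ('k ^ 'n) set) \<Rightarrow> bool" where
  "effective_action X \<alpha> \<longleftrightarrow> (\<forall>s. (\<forall>L\<in>X. \<alpha> s L = L) \<longrightarrow> s = 0)"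

definition open_orbit ::
  "('k::field ^ 'n) set set \<Rightarrow> ('k ^ 'g \<Rightarrow> ('k ^ 'n) set \<Rightarrow> ('k ^ 'n) set)
     \<Rightarrow> ('k ^ 'n) set set \<Rightarrow> bool" where
  "open_orbit X \<alpha> orb \<longleftrightarrow>
     (\<exists>L\<in>X. orb = range (\<lambda>s. \<alpha> s L)) \<and> zariski_closed (X - orb)"

definition additive_action ::
  "('k::field ^ 'n) set set \<Rightarrow> ('k ^ 'g \<Rightarrow> ('k ^ 'n) set \<Rightarrow> ('k ^ 'n) set) \<Rightarrow> bool" where
  "additive_action X \<alpha> \<longleftrightarrow> irreducible_closed X \<and> regular_action X \<alpha> \<and>
     effective_action X \<alpha> \<and> (\<exists>orb. open_orbit X \<alpha> orb)"

definition induced_additive_action ::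
  "('k::field ^ 'n) set set \<Rightarrow> ('k ^ 'g \<Rightarrow> ('k ^ 'n) set \<Rightarrow> ('k ^ 'n) set) \<Rightarrow> bool" where
  "induced_additive_action X \<alpha> \<longleftrightarrow> additive_action X \<alpha> \<and>
     (\<exists>\<beta> :: 'k ^ 'g \<Rightarrow> ('k ^ 'n) set \<Rightarrow> ('k ^ 'n) set.
        regular_action projective_space \<beta> \<and> (\<forall>s. \<forall>L\<in>X. \<beta> s L = \<alpha> s L))"


section \<open>H-pairs\<close>

text \<open>Algebras over \<open>'k\<close> are types of class \<^class>\<open>comm_ring_1\<close> with a scalar multiplication \<open>s\<close>;
  ideals are the subspaces for the multiplication of the ring.\<close>

definition fin_dim_algebra :: "('k::field \<Rightarrow> 'a::comm_ring_1 \<Rightarrow> 'a) \<Rightarrow> bool" where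
  "fin_dim_algebra s \<longleftrightarrow> vector_space s \<and> (\<forall>c x y. s c (x * y) = s c x * y) \<and>
     (\<exists>B. finite B \<and> module.span s B = UNIV)"

definition ring_ideal :: "'a::comm_ring_1 set \<Rightarrow> bool" where
  "ring_ideal J \<longleftrightarrow> module.subspace (*) J"

definition max_ideal :: "'a::comm_ring_1 set \<Rightarrow> bool" where
  "max_ideal J \<longleftrightarrow> ring_ideal J \<and> J \<noteq> UNIV \<and>
     (\<forall>I. ring_ideal I \<and> J \<subseteq> I \<longrightarrow> I = J \<or> I = UNIV)"

definition local_algebra ::
  "('k::field \<Rightarrow> 'a::comm_ring_1 \<Rightarrow> 'a) \<Rightarrow> 'a set \<Rightarrow> bool" where
  "local_algebra s \<mm> \<longleftrightarrow> fin_dim_algebra s \<and> {J. max_ideal J} = {\<mm>}"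

definition subalgebra :: "('k::field \<Rightarrow> 'a::comm_ring_1 \<Rightarrow> 'a) \<Rightarrow> 'a set \<Rightarrow> bool" where
  "subalgebra s S \<longleftrightarrow> module.subspace s S \<and> 1 \<in> S \<and> (\<forall>x\<in>S. \<forall>y\<in>S. x * y \<in> S)"

definition H_pair ::
  "('k::field \<Rightarrow> 'a::comm_ring_1 \<Rightarrow> 'a) \<Rightarrow> 'a set \<Rightarrow> 'a set \<Rightarrow> bool" where
  "H_pair s \<mm> U \<longleftrightarrow> local_algebra s \<mm> \<and>
     module.subspace s U \<and> U \<subseteq> \<mm> \<and>
     vector_space.dim s \<mm> = vector_space.dim s U + 1 \<and>
     (\<forall>S. subalgebra s S \<and> U \<subseteq> S \<longrightarrow> S = UNIV)"

text \<open>For nilpotent \<open>u\<close> the index set is finite and the sum is the exponential series.\<close>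

definition nilp_exp :: "('k::field_char_0 \<Rightarrow> 'a::comm_ring_1 \<Rightarrow> 'a) \<Rightarrow> 'a \<Rightarrow> 'a" where
  "nilp_exp s u = (\<Sum>k | u ^ k \<noteq> 0. s (inverse (fact k)) (u ^ k))"

definition exp_cone :: "('k::field_char_0 \<Rightarrow> 'a::comm_ring_1 \<Rightarrow> 'a) \<Rightarrow> 'a set \<Rightarrow> 'a set" where
  "exp_cone s U = {s c (nilp_exp s u) |c u. c \<noteq> 0 \<and> u \<in> U}"

text \<open>\<open>(X, \<alpha>)\<close> corresponds to the H-pair \<open>(A, U)\<close> via the linear isomorphism \<open>\<phi>\<close> from the
  coordinate space to \<open>A\<close>. The Zariski closure in \<open>A\<close> is taken in the coordinates given by \<open>\<phi>\<close>.
  The isomorphism of the acting group with \<open>exp U\<close> is \<open>exp \<circ> \<theta>\<close>; in characteristic zero every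
  isomorphism of vector groups is linear.\<close>

definition corresponds ::
  "('k::field_char_0 \<Rightarrow> 'a::comm_ring_1 \<Rightarrow> 'a) \<Rightarrow> 'a set \<Rightarrow> ('k ^ 'n \<Rightarrow> 'a) \<Rightarrow>
     ('k ^ 'n) set set \<Rightarrow> ('k ^ 'g \<Rightarrow> ('k ^ 'n) set \<Rightarrow> ('k ^ 'n) set) \<Rightarrow> bool" where
  "corresponds s U \<phi> X \<alpha> \<longleftrightarrow>
     Vector_Spaces.linear (*s) s \<phi> \<and> bij \<phi> \<and>
     image \<phi> ` X = proj_space s (\<phi> ` affine_closure (\<phi> -` exp_cone s U)) \<and>
     (\<exists>\<theta>. Vector_Spaces.linear (*s) s \<theta> \<and> inj \<theta> \<and> range \<theta> = U \<and>
        (\<forall>t x. x \<noteq> 0 \<and> pt x \<in> X \<longrightarrow>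
           \<phi> ` \<alpha> t (pt x) = line s (nilp_exp s (\<theta> t) * \<phi> x)))"

end

theory Submission
  imports Defs "HOL-Computational_Algebra.Formal_Power_Series"
begin

text \<open>
  Let \<open>\<pi>\<close> be a functional on \<open>\<mm>\<close> with kernel \<open>U\<close>. The closure of the cone over \<open>exp U\<close> is given by
  the homogenization \<open>F\<close> of \<open>\<pi> (ln (1 + m))\<close>, whose restriction to \<open>\<mm>\<close> is a multiple of
  \<open>\<pi> (z\<^sup>d)\<close>; irreducibility of \<open>X\<close> forces the open orbit to be the part of \<open>X\<close> outside \<open>\<mm>\<close>. Since
  \<open>U\<close> generates \<open>A\<close>, we have \<open>d \<ge> 2\<close>, and there is \<open>b \<in> \<mm>\<close> with \<open>b\<^sup>2 \<noteq> 0\<close>. By polarization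
  \<open>\<pi> (z\<^sup>d)\<close> is invariant under translation by \<open>b\<^sup>2\<close>, so that the boundary is a cone with vertex
  \<open>b\<^sup>2\<close>. A cone is singular at its vertex unless it is contained in, hence equal to, a hyperplane.
\<close>

section \<open>Polynomial functions\<close>

text \<open>The difficulty is that X is given only as a closure and its equation g only as a
  generator of an ideal. That F vanishes on X is immediate, but inside the projective space of
  \<open>\<mm>\<close> the exponential cone has no points, so there the converse cannot be read off.
  The relation F = g h settles it without any irreducibility statement about F: it is enough that h
  is a nonzero constant on \<open>\<mm>\<close>. The choice of b^2 comes from counting factors. In
  \<open>\<pi> ((z + t b^2)^d)\<close> the coefficient of t^i involves d - i copies of z and 2i
  copies of b, hence d + i elements of \<open>\<mm>\<close>, and d is chosen as the largest exponent
  for which \<open>\<pi>\<close> does not kill all powers. As b^d is nonzero and d is at least 2,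
  b^2 is nonzero. One device recurs: over an algebraically closed field a polynomial without zeros
  on a line is constant on it. It gives the invariance of every equation of the boundary, the
  equality with a hyperplane, and the constancy of h.\<close>

definition mon_eval :: "('i \<Rightarrow> 'k::comm_semiring_1) \<Rightarrow> ('i \<Rightarrow>\<^sub>0 nat) \<Rightarrow> 'k" where
  "mon_eval x \<mu> = (\<Prod>i\<in>Poly_Mapping.keys \<mu>. x i ^ Poly_Mapping.lookup \<mu> i)"

lemma mon_eval_superset:
  assumes "finite I" "Poly_Mapping.keys \<mu> \<subseteq> I"
  shows "mon_eval x \<mu> = (\<Prod>i\<in>I. x i ^ Poly_Mapping.lookup \<mu> i)"
  unfolding mon_eval_def using assms
  by (intro prod.mono_neutral_left) (auto simp: in_keys_iff)

lemma mon_eval_0 [simp]: "mon_eval x 0 = 1"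
  by (simp add: mon_eval_def)

lemma mon_eval_add: "mon_eval x (\<mu> + \<nu>) = mon_eval x \<mu> * mon_eval x \<nu>"
proof -
  let ?I = "Poly_Mapping.keys \<mu> \<union> Poly_Mapping.keys \<nu>"
  have "Poly_Mapping.keys (\<mu> + \<nu>) \<subseteq> ?I" by (rule keys_add)
  then show ?thesis
    by (simp add: mon_eval_superset[of ?I] lookup_add power_add prod.distrib)
qed

lemma peval_superset:
  assumes "finite M" "Poly_Mapping.keys f \<subseteq> M"
  shows "peval x f = (\<Sum>\<mu>\<in>M. Poly_Mapping.lookup f \<mu> * mon_eval x \<mu>)"
  unfolding peval_def mon_eval_def using assms
  by (intro sum.mono_neutral_left) (auto simp: in_keys_iff)

lemma peval_0 [simp]: "peval x 0 = 0"
  by (simp add: peval_def)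

lemma peval_add: "peval x (f + g) = peval x f + peval x g"
proof -
  let ?M = "Poly_Mapping.keys f \<union> Poly_Mapping.keys g"
  have "Poly_Mapping.keys (f + g) \<subseteq> ?M" by (rule keys_add)
  then show ?thesis
    by (simp add: peval_superset[of ?M] lookup_add distrib_right sum.distrib)
qed

lemma peval_sum: "peval x (\<Sum>i\<in>I. f i) = (\<Sum>i\<in>I. peval x (f i))"
  by (induction I rule: infinite_finite_induct) (simp_all add: peval_add)

lemma peval_single: "peval x (Poly_Mapping.single \<mu> c) = c * mon_eval x \<mu>"
  by (subst peval_superset[of "{\<mu>}"]) auto

lemma sum_single_lookup:
  "(\<Sum>\<mu>\<in>Poly_Mapping.keys f. Poly_Mapping.single \<mu> (Poly_Mapping.lookup f \<mu>)) = f"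
  by (rule poly_mapping_eqI)
    (auto simp: lookup_sum lookup_single when_def sum.delta in_keys_iff)

text \<open>Expanding both factors into single terms reduces the claim to \<open>mult_single\<close>
  and \<open>mon_eval_add\<close> and avoids the convolution that defines the product.\<close>

lemma peval_mult: "peval x (f * g) = peval x f * peval x g"
proof -
  have "peval x (f * g) = peval x
    ((\<Sum>\<mu>\<in>Poly_Mapping.keys f. Poly_Mapping.single \<mu> (Poly_Mapping.lookup f \<mu>)) *
     (\<Sum>\<mu>\<in>Poly_Mapping.keys g. Poly_Mapping.single \<mu> (Poly_Mapping.lookup g \<mu>)))"
    by (simp only: sum_single_lookup)
  also have "\<dots> = peval x f * peval x g"
    unfolding sum_product peval_sum mult_single peval_single
    by (simp add: peval_def mon_eval_add sum_product mult_ac flip: mon_eval_def)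
  finally show ?thesis .
qed

lemma vec_nth_vec_lambda: "($) (\<chi> i. y i) = y"
  by (rule ext) simp

text \<open>The set \<open>E\<close> of admissible exponents lets one calculus serve three purposes:
  homogeneity of a given degree, absence of a variable, and (with \<open>UNIV\<close>) mere
  polynomiality.\<close>

definition polyfun :: "('n::finite \<Rightarrow>\<^sub>0 nat) set \<Rightarrow> ('k::field ^ 'n \<Rightarrow> 'k) \<Rightarrow> bool" where
  "polyfun E P \<longleftrightarrow> (\<exists>f. Poly_Mapping.keys f \<subseteq> E \<and> (\<forall>x. P x = peval (($) x) f))"

lemma polyfun_mono: "polyfun D P \<Longrightarrow> D \<subseteq> E \<Longrightarrow> polyfun E P"
  unfolding polyfun_def by blast

lemma polyfun_zero: "polyfun E (\<lambda>x. 0)"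
  unfolding polyfun_def by (intro exI[of _ 0]) auto

lemma polyfun_const: "0 \<in> E \<Longrightarrow> polyfun E (\<lambda>x. c)"
  unfolding polyfun_def by (intro exI[of _ "Poly_Mapping.single 0 c"]) (auto simp: peval_single)

lemma polyfun_coord: "Poly_Mapping.single i 1 \<in> E \<Longrightarrow> polyfun E (\<lambda>x. x $ i)"
  unfolding polyfun_def
  by (intro exI[of _ "Poly_Mapping.single (Poly_Mapping.single i 1) 1"])
     (auto simp: peval_single mon_eval_def)

lemma polyfun_add: "polyfun E P \<Longrightarrow> polyfun E Q \<Longrightarrow> polyfun E (\<lambda>x. P x + Q x)"
  unfolding polyfun_def by (metis (no_types) keys_add le_sup_iff order_trans peval_add)

lemma polyfun_mult:
  assumes "polyfun D P" "polyfun E Q" "\<And>\<mu> \<nu>. \<mu> \<in> D \<Longrightarrow> \<nu> \<in> E \<Longrightarrow> \<mu> + \<nu> \<in> E'"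
  shows "polyfun E' (\<lambda>x. P x * Q x)"
proof -
  obtain f g where f: "Poly_Mapping.keys f \<subseteq> D" "\<And>x. P x = peval (($) x) f"
    and g: "Poly_Mapping.keys g \<subseteq> E" "\<And>x. Q x = peval (($) x) g"
    using assms(1,2) unfolding polyfun_def by blast
  have "Poly_Mapping.keys (f * g) \<subseteq> E'"
    using keys_mult[of f g] f(1) g(1) assms(3) by blast
  then show ?thesis
    unfolding polyfun_def using f(2) g(2) by (intro exI[of _ "f * g"]) (simp add: peval_mult)
qed

lemma polyfun_sum: "(\<And>i. i \<in> I \<Longrightarrow> polyfun E (P i)) \<Longrightarrow> polyfun E (\<lambda>x. \<Sum>i\<in>I. P i x)"
  by (induction I rule: infinite_finite_induct) (simp_all add: polyfun_zero polyfun_add)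

lemma polyfun_prod:
  assumes "0 \<in> E" "\<And>\<mu> \<nu>. \<mu> \<in> E \<Longrightarrow> \<nu> \<in> E \<Longrightarrow> \<mu> + \<nu> \<in> E"
  shows "(\<And>i. i \<in> I \<Longrightarrow> polyfun E (P i)) \<Longrightarrow> polyfun E (\<lambda>x. \<Prod>i\<in>I. P i x)"
  by (induction I rule: infinite_finite_induct)
     (auto intro: polyfun_const polyfun_mult[where D=E and E=E] assms)

lemma polyfun_power:
  assumes "0 \<in> E" "\<And>\<mu> \<nu>. \<mu> \<in> E \<Longrightarrow> \<nu> \<in> E \<Longrightarrow> \<mu> + \<nu> \<in> E" "polyfun E P"
  shows "polyfun E (\<lambda>x. P x ^ k)"
  using polyfun_prod[of E "{..<k}" "\<lambda>_. P"] assms by simp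

lemma polyfun_compose:
  assumes "0 \<in> E" "\<And>\<mu> \<nu>. \<mu> \<in> E \<Longrightarrow> \<nu> \<in> E \<Longrightarrow> \<mu> + \<nu> \<in> E" "\<And>i. polyfun E (\<lambda>x. y x i)"
  shows "polyfun E (\<lambda>x. peval (y x) f)"
  unfolding peval_def
  by (intro polyfun_sum polyfun_mult[where D=E and E=E] polyfun_const polyfun_prod polyfun_power assms)

section \<open>Homogeneous polynomials\<close>

abbreviation exponents_of_degree :: "nat \<Rightarrow> ('i \<Rightarrow>\<^sub>0 nat) set" where
  "exponents_of_degree d \<equiv> {\<mu>. (\<Sum>i\<in>Poly_Mapping.keys \<mu>. Poly_Mapping.lookup \<mu> i) = d}"

lemma homogeneous_iff: "homogeneous d f \<longleftrightarrow> Poly_Mapping.keys f \<subseteq> exponents_of_degree d"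
  by (auto simp: homogeneous_in_def)

lemma exponents_of_degree_add:
  assumes "\<mu> \<in> exponents_of_degree d" "\<nu> \<in> exponents_of_degree e"
  shows "\<mu> + \<nu> \<in> exponents_of_degree (d + e)"
proof -
  let ?I = "Poly_Mapping.keys \<mu> \<union> Poly_Mapping.keys \<nu>"
  have *: "(\<Sum>i\<in>Poly_Mapping.keys \<rho>. Poly_Mapping.lookup \<rho> i) = (\<Sum>i\<in>?I. Poly_Mapping.lookup \<rho> i)"
    if "Poly_Mapping.keys \<rho> \<subseteq> ?I" for \<rho>
    using that by (intro sum.mono_neutral_left) (auto simp: in_keys_iff)
  show ?thesis
    using assms *[OF keys_add] *[of \<mu>] *[of \<nu>] by (simp add: lookup_add sum.distrib)
qed

lemma peval_homogeneous:
  assumes "homogeneous d f"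
  shows "peval (\<lambda>i. c * x i) f = c ^ d * peval x f"
  using assms unfolding peval_def homogeneous_in_def
  by (auto simp: power_mult_distrib prod.distrib sum_distrib_left mult_ac power_sum[symmetric]
      intro!: sum.cong)

lemma peval_homogeneous_scale:
  "homogeneous d f \<Longrightarrow> peval (($) (c *s x)) f = c ^ d * peval (($) x) f"
  using peval_homogeneous[of d f c "($) x"]
  by (simp add: vector_scalar_mult_def vec_nth_vec_lambda)

lemma peval_homogeneous_zero:
  fixes f :: "('n::finite, 'k::field) mpoly"
  shows "homogeneous d f \<Longrightarrow> d > 0 \<Longrightarrow> peval (($) 0) f = 0"
  using peval_homogeneous[of d f 0 "\<lambda>_. 0"] by (simp add: zero_vec_def vec_nth_vec_lambda power_0_left)

lemma polyfun_homogeneousE: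
  assumes "polyfun (exponents_of_degree d) P"
  obtains f where "homogeneous d f" "\<And>x. P x = peval (($) x) f"
  using assms unfolding polyfun_def homogeneous_iff by blast

text \<open>One factor \<open>L x\<close> is expanded in the standard basis. What remains is the
  functional \<open>\<eta>\<close> precomposed with multiplication by \<open>L (axis i 1)\<close>,
  applied to a lower power; hence the induction over all \<open>\<eta>\<close>.\<close>

lemma polyfun_functional_power:
  fixes s :: "'k::field \<Rightarrow> 'a::comm_ring_1 \<Rightarrow> 'a"
  assumes L: "Vector_Spaces.linear (*s) s L" and l: "Vector_Spaces.linear s (*) \<eta>"
    and s: "\<And>c x y. s c (x * y) = s c x * y"
  shows "polyfun (exponents_of_degree k) (\<lambda>x::'k^'n::finite. \<eta> (L x ^ k))"
  using l
proof (induction k arbitrary: \<eta>)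
  case 0
  show ?case by (simp add: polyfun_const)
next
  case (Suc k)
  interpret L: Vector_Spaces.linear "(*s)" s L by fact
  interpret l: Vector_Spaces.linear s "(*)" \<eta> by fact
  have "\<eta> (L x ^ Suc k) = (\<Sum>i\<in>UNIV. x $ i * \<eta> (L (axis i 1) * L x ^ k))" for x
  proof -
    have "L x = (\<Sum>i\<in>UNIV. s (x $ i) (L (axis i 1)))"
      by (subst basis_expansion[of x, symmetric]) (simp only: L.sum L.scale)
    then have "L x ^ Suc k = (\<Sum>i\<in>UNIV. s (x $ i) (L (axis i 1))) * L x ^ k" by simp
    then show ?thesis
      by (simp add: sum_distrib_right l.sum flip: s l.scale)
  qed
  moreover have "polyfun (exponents_of_degree (Suc k))
      (\<lambda>x. \<Sum>i\<in>UNIV. x $ i * \<eta> (L (axis i 1) * L x ^ k))"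
  proof (intro polyfun_sum polyfun_mult)
    show "polyfun (exponents_of_degree 1) (\<lambda>x. x $ i)" for i :: 'n
      by (intro polyfun_coord) simp
    have "Vector_Spaces.linear s (*) (\<lambda>y. \<eta> (L (axis i 1) * y))" for i
      by unfold_locales
         (simp_all add: distrib_left l.add s mult.commute[of "L (axis i 1)"] flip: l.scale)
    then show "polyfun (exponents_of_degree k) (\<lambda>x. \<eta> (L (axis i 1) * L x ^ k))" for i
      by (rule Suc.IH)
  qed (use exponents_of_degree_add[of _ 1 _ k] in simp)
  ultimately show ?case by simp
qed

section \<open>Restriction to curves and directional derivatives\<close>

lemma peval_along_poly_curve:
  fixes f :: "('i, 'k::field) mpoly"
  assumes "\<And>i t. x t i = poly (q i) t"
  shows "\<exists>Q. \<forall>t. peval (x t) f = poly Q t"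
proof
  show "\<forall>t. peval (x t) f = poly (\<Sum>\<mu>\<in>Poly_Mapping.keys f.
      smult (Poly_Mapping.lookup f \<mu>) (\<Prod>i\<in>Poly_Mapping.keys \<mu>. q i ^ Poly_Mapping.lookup \<mu> i)) t"
    by (simp add: peval_def poly_sum poly_prod assms)
qed

lemma peval_along_line:
  "\<exists>Q. \<forall>t. peval (($) (x + t *s y)) f = poly Q t" for x y :: "'k::field ^ 'n"
  by (rule peval_along_poly_curve[where q="\<lambda>i. [:x $ i, y $ i:]"]) simp

lemma poly_pderiv_along_line:
  fixes x y :: "'k::field_char_0 ^ 'n::finite"
  assumes "\<And>t. peval (($) (x + t *s y)) f = poly Q t"
  shows "poly (pderiv Q) 0 = (\<Sum>i\<in>UNIV. y $ i * peval (($) x) (pderiv_in i f))"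
proof -
  define q where "q = (\<lambda>i. [:x $ i, y $ i:])"
  \<comment> \<open>\<open>Q\<close> is known only through its values, which determine it over an
    infinite field; \<open>Q'\<close> is an explicit form that can be differentiated.\<close>
  define Q' where "Q' = (\<Sum>\<mu>\<in>Poly_Mapping.keys f.
      smult (Poly_Mapping.lookup f \<mu>) (\<Prod>i\<in>UNIV. q i ^ Poly_Mapping.lookup \<mu> i))"
  have "poly Q t = poly Q' t" for t
    unfolding assms(1)[symmetric] Q'_def peval_superset[OF finite_keys order_refl]
      mon_eval_superset[OF finite subset_UNIV]
    by (simp add: poly_sum poly_prod q_def)
  then have "Q = Q'"
    by (simp add: poly_eq_poly_eq_iff[symmetric] fun_eq_iff)
  \<comment> \<open>If the variable i does not occur in the monomial, both truncated exponents are 0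
    and the factor \<open>of_nat 0\<close> kills the term.\<close>
  have aux: "(\<Prod>j\<in>UNIV - {i}. x $ j ^ Poly_Mapping.lookup \<mu> j) *
       (of_nat (Poly_Mapping.lookup \<mu> i) * (x $ i ^ (Poly_Mapping.lookup \<mu> i - Suc 0) * y $ i)) =
     y $ i * (of_nat (Poly_Mapping.lookup \<mu> i) * mon_eval (($) x) (\<mu> - Poly_Mapping.single i 1))"
    for \<mu> i
    by (subst mon_eval_superset[OF finite subset_UNIV], subst prod.remove[of UNIV i])
       (auto simp: lookup_minus lookup_single when_def mult_ac intro!: prod.cong)
  have "poly (pderiv Q') 0 = (\<Sum>\<mu>\<in>Poly_Mapping.keys f. Poly_Mapping.lookup f \<mu> *
      (\<Sum>i\<in>UNIV. (\<Prod>j\<in>UNIV - {i}. x $ j ^ Poly_Mapping.lookup \<mu> j) *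
        (of_nat (Poly_Mapping.lookup \<mu> i) * (x $ i ^ (Poly_Mapping.lookup \<mu> i - Suc 0) * y $ i))))"
    unfolding Q'_def q_def
    by (simp add: higher_pderiv_sum[where n=1, simplified] poly_sum pderiv_smult pderiv_prod
        pderiv_power poly_prod pderiv_pCons mult_ac)
  also have "\<dots> = (\<Sum>\<mu>\<in>Poly_Mapping.keys f. \<Sum>i\<in>UNIV. y $ i *
      (of_nat (Poly_Mapping.lookup \<mu> i) * Poly_Mapping.lookup f \<mu> *
        mon_eval (($) x) (\<mu> - Poly_Mapping.single i 1)))"
    unfolding aux sum_distrib_left by (simp only: mult_ac)
  also have "\<dots> = (\<Sum>i\<in>UNIV. y $ i * peval (($) x) (pderiv_in i f))"
    unfolding pderiv_in_def peval_sum peval_single sum_distrib_left by (rule sum.swap)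
  finally show ?thesis by (simp add: \<open>Q = Q'\<close>)
qed

section \<open>Points and cones\<close>

lemma line_eq_iff:
  assumes "vector_space s" "x \<noteq> 0" "y \<noteq> 0"
  shows "line s x = line s y \<longleftrightarrow> (\<exists>c. c \<noteq> 0 \<and> x = s c y)"
proof -
  interpret vector_space s by fact
  show ?thesis
  proof
    assume "line s x = line s y"
    then have "s 1 x \<in> line s y" unfolding line_def by blast
    then obtain c where "x = s c y" unfolding line_def by auto
    then show "\<exists>c. c \<noteq> 0 \<and> x = s c y" using assms(2) by auto
  next
    assume "\<exists>c. c \<noteq> 0 \<and> x = s c y"
    then obtain c where c: "c \<noteq> 0" "x = s c y" by blast
    have "s a x = s (a * c) y" "s a y = s (a / c) x" for a
      using c by auto
    then show "line s x = line s y"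
      unfolding line_def by (intro equalityI image_subsetI) (metis rangeI)+
  qed
qed

lemma self_in_line: "vector_space s \<Longrightarrow> x \<in> line s x"
  unfolding line_def by (metis rangeI vector_space.vector_space_assms(4))

lemma image_line:
  assumes "Vector_Spaces.linear s s' f"
  shows "f ` line s x = line s' (f x)"
proof -
  interpret Vector_Spaces.linear s s' f by fact
  show ?thesis by (simp add: line_def image_image scale)
qed

lemma pt_eq_iff: "x \<noteq> 0 \<Longrightarrow> y \<noteq> 0 \<Longrightarrow> pt x = pt y \<longleftrightarrow> (\<exists>c. c \<noteq> 0 \<and> x = c *s y)"
  unfolding pt_def by (rule line_eq_iff) (rule vec.vector_space_axioms)

lemma projective_space_eq: "projective_space = {pt x |x. x \<noteq> 0}"
  by (auto simp: projective_space_def proj_space_def pt_def)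

text \<open>\<open>zero_locus\<close> asks for one representative that is a common zero; homogeneity
  passes this on to every representative.\<close>

lemma pt_in_zero_locus_iff:
  assumes "\<And>f. f \<in> S \<Longrightarrow> \<exists>d. homogeneous d f" "x \<noteq> 0"
  shows "pt x \<in> zero_locus S \<longleftrightarrow> (\<forall>f\<in>S. peval (($) x) f = 0)"
proof
  assume "pt x \<in> zero_locus S"
  then obtain y where y: "y \<noteq> 0" "pt x = pt y" "\<forall>f\<in>S. peval (($) y) f = 0"
    by (auto simp: zero_locus_def)
  then obtain c where "x = c *s y" using assms(2) pt_eq_iff by blast
  then show "\<forall>f\<in>S. peval (($) x) f = 0"
    using y(3) assms(1) peval_homogeneous_scale by fastforce
qed (use assms(2) in \<open>auto simp: zero_locus_def\<close>)

lemma zero_locusE: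
  assumes "L \<in> zero_locus S"
  obtains x where "x \<noteq> 0" "L = pt x"
  using assms by (auto simp: zero_locus_def)

lemma pt_in_hypersurface_iff:
  assumes "hypersurface_eq g X" "x \<noteq> 0"
  shows "pt x \<in> X \<longleftrightarrow> peval (($) x) g = 0"
proof -
  have "\<exists>d. homogeneous d g" "X = zero_locus {g}"
    using assms(1) by (auto simp: hypersurface_eq_def)
  then show ?thesis using pt_in_zero_locus_iff[of "{g}" x] assms(2) by simp
qed

lemma alg_closed_rootless_constant:
  fixes Q :: "'k::alg_closed_field poly"
  assumes "\<And>t. poly Q t \<noteq> 0"
  shows "poly Q s = poly Q t"
proof -
  have "degree Q = 0" using alg_closed_imp_poly_has_root[of Q] assms by auto
  then obtain c where "Q = [:c:]" by (rule degree_eq_zeroE)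
  then show ?thesis by simp
qed

lemma dim_range_injective_linear:
  fixes f :: "'k::field ^ 'n::finite \<Rightarrow> 'a::ab_group_add"
  assumes f: "Vector_Spaces.linear (*s) s f" "inj f"
  shows "vector_space.dim s (range f) = CARD('n)"
proof -
  interpret f: Vector_Spaces.linear "(*s)" s f by fact
  have "finite_dimensional_vector_space_pair_1 (*s) (cart_basis :: ('k ^ 'n) set) s"
    by (intro finite_dimensional_vector_space_pair_1.intro vec.finite_dimensional_vector_space_axioms
        f.vs2.vector_space_axioms)
  from finite_dimensional_vector_space_pair_1.dim_image_eq[OF this f(1), of UNIV] f(2)
  show ?thesis by (simp add: vec_dim_card del: vec.dim_UNIV)
qed

section \<open>Linear changes of coordinates and cones\<close>

lemma exists_invertible_matrix_column:
  fixes w :: "'k::field ^ 'n::finite"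
  assumes "w $ i \<noteq> 0"
  obtains M :: "'k ^ 'n ^ 'n"
  where "invertible M" "\<And>x. M *v x = x - x $ i *s axis i 1 + x $ i *s w"
proof -
  \<comment> \<open>The identity matrix with column i replaced by w: coordinate i of the image is
    x_i w_i, so a vector in the kernel has x_i = 0 and is then fixed by f.\<close>
  define f where "f = (\<lambda>x. x - x $ i *s axis i 1 + x $ i *s w)"
  have f: "Vector_Spaces.linear (*s) (*s) f"
    by unfold_locales (simp_all add: f_def algebra_simps vec_eq_iff)
  have "inj f"
  proof -
    interpret f: Vector_Spaces.linear "(*s)" "(*s)" f by fact
    have "x = 0" if "f x = 0" for x
    proof -
      have "f x $ i = 0" using that by simp
      then have "x $ i = 0" using assms by (simp add: f_def)
      then show "x = 0" using that by (simp add: f_def)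
    qed
    then show ?thesis using f.inj_iff_eq_0 by blast
  qed
  then have "invertible (matrix f)"
    unfolding invertible_left_inverse matrix_left_invertible_injective matrix_works[OF f] .
  then show ?thesis using that[of "matrix f"] matrix_works[OF f] by (simp add: f_def)
qed

text \<open>In coordinates where w is the basis vector i, invariance along w says that x_i does not
  matter, so it may be set to 0.\<close>

lemma depends_on_fewer_variables_if_translation_invariant:
  fixes g :: "('n::finite, 'k::field) mpoly"
  assumes "\<And>x t. peval (($) (x + t *s w)) g = peval (($) x) g" "w \<noteq> 0"
  shows "depends_on_fewer_variables g"
proof -
  obtain i where i: "w $ i \<noteq> 0" using assms(2) by (auto simp: vec_eq_iff)
  obtain M :: "'k ^ 'n ^ 'n" where M: "invertible M"
    "\<And>x. M *v x = x - x $ i *s axis i 1 + x $ i *s w"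
    using exists_invertible_matrix_column[OF i] by blast
  let ?E = "{\<mu>. Poly_Mapping.keys \<mu> \<subseteq> UNIV - {i}}"
  have "polyfun ?E (\<lambda>x. peval (\<lambda>j. if j = i then 0 else x $ j) g)"
  proof (rule polyfun_compose)
    show "\<mu> + \<nu> \<in> ?E" if "\<mu> \<in> ?E" "\<nu> \<in> ?E" for \<mu> \<nu>
      using that keys_add[of \<mu> \<nu>] by blast
    show "polyfun ?E (\<lambda>x. if j = i then 0 else x $ j)" for j
      by (cases "j = i") (auto intro: polyfun_zero polyfun_coord)
  qed simp
  then obtain h where h: "Poly_Mapping.keys h \<subseteq> ?E"
    "\<And>x. peval (\<lambda>j. if j = i then 0 else x $ j) g = peval (($) x) h"
    unfolding polyfun_def by blast
  have "peval (($) (M *v x)) g = peval (($) x) h" for x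
  proof -
    have "($) (x - x $ i *s axis i 1) = (\<lambda>j. if j = i then 0 else x $ j)"
      by (auto simp: axis_def)
    then show ?thesis unfolding M(2) assms(1) by (simp only: h(2))
  qed
  moreover have "card (pvars h) < CARD('n)"
  proof (rule psubset_card_mono)
    have "i \<notin> pvars h" using h(1) by (auto simp: pvars_def)
    then show "pvars h \<subset> UNIV" by blast
  qed simp
  ultimately show ?thesis unfolding depends_on_fewer_variables_def using M(1) by blast
qed

text \<open>Degeneracy speaks of every equation q of Y, not only of G. On a line in direction w such
  a q vanishes everywhere or nowhere, which forces invariance. For the second part, let l be the
  differential at w of some f in the ideal. The cone over Y contains w + t x along with x, so f
  vanishes there and l x = 0. A nonzero l thus confines Y to a hyperplane, and algebraic closedness
  gives equality.\<close>

lemma hypersurface_with_vertex: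
  fixes w :: "'k::{alg_closed_field, field_char_0} ^ 'n::finite"
  assumes G: "hypersurface_eq G Y" and "homogeneous d G" "d \<ge> 1"
    and w: "w \<noteq> 0" "\<And>x t. peval (($) (x + t *s w)) G = peval (($) x) G"
  shows "degenerate_hypersurface Y \<and> (singular_hypersurface Y \<or> hyperplane Y)"
proof -
  have hyp: "hypersurface Y" using G unfolding hypersurface_def by blast
  have G0: "peval (($) 0) G = 0" using peval_homogeneous_zero[OF assms(2)] assms(3) by simp
  have Gw: "peval (($) (t *s w)) G = 0" for t using w(2)[of 0 t] G0 by simp
  have Y: "Y = {pt x |x. x \<noteq> 0 \<and> peval (($) x) G = 0}"
    using G by (auto simp: hypersurface_eq_def zero_locus_def)
  have "depends_on_fewer_variables q" if q: "hypersurface_eq q Y" for q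
  proof (rule depends_on_fewer_variables_if_translation_invariant[OF _ w(1)])
    have same: "peval (($) x) q = 0 \<longleftrightarrow> peval (($) x) G = 0" for x
    proof (cases "x = 0")
      case True
      then show ?thesis using G0 q peval_homogeneous_zero by (auto simp: hypersurface_eq_def)
    next
      case False
      then show ?thesis using pt_in_hypersurface_iff[OF q] pt_in_hypersurface_iff[OF G] by metis
    qed
    fix x t
    show "peval (($) (x + t *s w)) q = peval (($) x) q"
    proof (cases "peval (($) x) G = 0")
      case True
      then show ?thesis using same w(2) by metis
    next
      case False
      obtain Q where Q: "\<And>t. peval (($) (x + t *s w)) q = poly Q t"
        using peval_along_line by blast
      \<comment> \<open>On this line G is constant and nonzero, and q has the same zeros as
        G.\<close>
      have "poly Q t \<noteq> 0" for t using False same w(2) Q by metis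
      then have "poly Q t = poly Q 0" by (rule alg_closed_rootless_constant)
      then show ?thesis using Q[of t] Q[of 0] by simp
    qed
  qed
  moreover have "singular_hypersurface Y \<or> hyperplane Y"
  proof (rule disjCI)
    assume not_hyperplane: "\<not> hyperplane Y"
    have "peval (($) w) (pderiv_in i f) = 0" if f: "f \<in> vanishing_ideal Y" for f i
    proof (rule ccontr)
      assume nz: "peval (($) w) (pderiv_in i f) \<noteq> 0"
      define l where "l = (\<lambda>x::'k^'n. \<Sum>i\<in>UNIV. x $ i * peval (($) w) (pderiv_in i f))"
      have l_add: "l (x + t *s y) = l x + t * l y" for x y t
        by (simp add: l_def distrib_right sum.distrib sum_distrib_left mult.assoc)
      have l0: "l x = 0" if x: "peval (($) x) G = 0" for x
      proof -
        obtain Q where Q: "\<And>t. peval (($) (w + t *s x)) f = poly Q t"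
          using peval_along_line by blast
        have "peval (($) (w + t *s x)) f = 0" if "w + t *s x \<noteq> 0" for t
        proof -
          have "peval (($) (w + t *s x)) G = peval (($) (t *s x + 1 *s w)) G"
            by (simp add: add.commute)
          also have "\<dots> = 0"
            using peval_homogeneous_scale[OF assms(2)] x by (simp only: w(2)) simp
          finally show ?thesis using f that Y by (auto simp: vanishing_ideal_def)
        qed
        \<comment> \<open>Membership in \<open>vanishing_ideal\<close> says nothing at the zero
          vector, so the parameter at which the line may meet it is set aside.\<close>
        moreover have "finite {t. w + t *s x = 0}"
        proof -
          obtain j where "w $ j \<noteq> 0" using w(1) by (auto simp: vec_eq_iff)
          have "t = - w $ j / x $ j" if "w + t *s x = 0" for t
          proof -
            have "w $ j + t * x $ j = 0" using that by (simp add: vec_eq_iff)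
            moreover from this have "x $ j \<noteq> 0" using \<open>w $ j \<noteq> 0\<close> by auto
            ultimately show ?thesis
              by (metis nonzero_eq_divide_eq eq_neg_iff_add_eq_0 add.commute)
          qed
          then have "{t. w + t *s x = 0} \<subseteq> {- w $ j / x $ j}" by blast
          then show ?thesis by (rule finite_subset) simp
        qed
        ultimately have "finite {t. poly Q t \<noteq> 0}"
          using Q by (metis (mono_tags, lifting) Collect_mono finite_subset)
        then have "infinite {t. poly Q t = 0}"
          using infinite_UNIV_char_0[where 'a='k] finite_Collect_disjI[of "\<lambda>t. poly Q t = 0" "\<lambda>t. poly Q t \<noteq> 0"]
          by simp
        then have "Q = 0" using poly_roots_finite by blast
        then show ?thesis using poly_pderiv_along_line[OF Q] by (simp add: l_def)
      qed
      have li: "l (axis i 1) \<noteq> 0"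
        using nz by (simp add: l_def axis_def if_distrib[of "\<lambda>a. a * _"] cong: if_cong)
      have G_iff: "peval (($) x) G = 0 \<longleftrightarrow> l x = 0" for x
      proof
        assume lx: "l x = 0"
        obtain Q where Q: "\<And>t. peval (($) (x + t *s axis i 1)) G = poly Q t"
          using peval_along_line by blast
        show "peval (($) x) G = 0"
        proof (rule ccontr)
          assume "peval (($) x) G \<noteq> 0"
          \<comment> \<open>Along the direction \<open>axis i 1\<close> the value of l is t times a
            nonzero constant, so a zero of G could occur only at t = 0, where G x is
            nonzero.\<close>
          have "poly Q t \<noteq> 0" for t
          proof
            assume "poly Q t = 0"
            then have "l (x + t *s axis i 1) = 0" using Q l0 by metis
            then have "t = 0" using lx li l_add by simp
            then show False using \<open>poly Q t = 0\<close> Q[of 0] \<open>peval (($) x) G \<noteq> 0\<close> by simp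
          qed
          then have const: "poly Q t = poly Q 0" for t by (rule alg_closed_rootless_constant)
          \<comment> \<open>Exchanging the roles of x and \<open>axis i 1\<close> brings the value
            of G at \<open>axis i 1\<close> to t = 0. There a constant times t^d vanishes because d
            is at least 1, although l does not vanish at \<open>axis i 1\<close>.\<close>
          obtain R where R: "\<And>t. peval (($) (axis i 1 + t *s x)) G = poly R t"
            using peval_along_line by blast
          \<comment> \<open>\<open>R\<close> is the reversal of \<open>Q\<close>\<close>
          have "poly R t = t ^ d * poly Q 0" if "t \<noteq> 0" for t
          proof -
            have "axis i 1 + t *s x = t *s (x + inverse t *s axis i 1)"
              using that by (simp add: vec_eq_iff distrib_left)
            then have "poly R t = t ^ d * poly Q (inverse t)"
              using peval_homogeneous_scale[OF assms(2)] R Q by metis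
            then show ?thesis using const[of "inverse t"] by simp
          qed
          then have "- {0} \<subseteq> {t. poly (R - monom (poly Q 0) d) t = 0}"
            by (auto simp: poly_monom)
          moreover have "infinite (- {0::'k})"
            using infinite_UNIV_char_0[where 'a='k] by simp
          ultimately have "infinite {t. poly (R - monom (poly Q 0) d) t = 0}"
            using finite_subset by blast
          then have "R - monom (poly Q 0) d = 0" using poly_roots_finite by blast
          then have "poly R 0 = 0" using assms(3) by (simp add: poly_monom)
          then have "peval (($) (axis i 1)) G = 0" using R[of 0] by simp
          then show False using l0 li by blast
        qed
      qed (rule l0)
      have "polyfun (exponents_of_degree 1) l"
      proof -
        have "polyfun (exponents_of_degree 1) (\<lambda>x. x $ j * peval (($) w) (pderiv_in j f))" for j
          by (rule polyfun_mult[where D="exponents_of_degree 1" and E="{0}"])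
             (auto intro: polyfun_coord polyfun_const)
        then show ?thesis unfolding l_def by (intro polyfun_sum)
      qed
      then obtain L where L: "homogeneous 1 L" "\<And>x. l x = peval (($) x) L"
        by (rule polyfun_homogeneousE) blast
      have "L \<noteq> 0" using li L(2) by auto
      moreover have "Y = zero_locus {L}"
        unfolding Y zero_locus_def by (simp add: G_iff L(2))
      ultimately show False using not_hyperplane L(1) unfolding hyperplane_def by blast
    qed
    moreover have "pt w \<in> Y" using Gw[of 1] w(1) Y by auto
    ultimately show "singular_hypersurface Y"
      unfolding singular_hypersurface_def using hyp w(1) by blast
  qed
  ultimately show ?thesis unfolding degenerate_hypersurface_def using hyp by blast
qed

section \<open>Power series of nilpotent elements\<close>

locale comm_algebra = vector_space scale
  for scale :: "'k::field_char_0 \<Rightarrow> 'a::comm_ring_1 \<Rightarrow> 'a" +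
  assumes scale_mult: "scale c (x * y) = scale c x * y"
begin

lemma mult_scale: "x * scale c y = scale c (x * y)"
  by (metis mult.commute scale_mult)

lemma scale_power: "scale c x ^ k = scale (c ^ k) (x ^ k)"
  by (induction k) (simp_all add: mult_scale flip: scale_mult)

lemma of_nat_mult_eq_scale: "of_nat c * x = scale (of_nat c) x"
  by (induction c) (simp_all add: distrib_right scale_left_distrib)

lemma linear_mult: "Vector_Spaces.linear scale (*) l \<Longrightarrow> Vector_Spaces.linear scale (*) (\<lambda>y. l (x * y))"
proof -
  assume "Vector_Spaces.linear scale (*) l"
  then interpret l: Vector_Spaces.linear scale "(*)" l .
  show ?thesis by unfold_locales (simp_all add: distrib_left l.add mult_scale l.scale)
qed

text \<open>For z^N = 0 this is multiplicative and compatible with composition, so that formal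
  identities, above all the inversion of exp and log, pass to nilpotent elements.\<close>

definition fps_eval :: "nat \<Rightarrow> 'k fps \<Rightarrow> 'a \<Rightarrow> 'a" where
  "fps_eval N f z = (\<Sum>k<N. scale (fps_nth f k) (z ^ k))"

lemma power_eq_0_mono: "z ^ N = (0::'a) \<Longrightarrow> N \<le> k \<Longrightarrow> z ^ k = 0"
  by (metis le_add_diff_inverse mult_zero_left power_add)

lemma fps_eval_add: "fps_eval N (f + g) z = fps_eval N f z + fps_eval N g z"
  by (simp add: fps_eval_def scale_left_distrib sum.distrib)

lemma fps_eval_1: "N > 0 \<Longrightarrow> fps_eval N 1 z = 1"
  unfolding fps_eval_def by (subst sum.remove[of _ 0]) auto

lemma fps_eval_X: "z ^ N = 0 \<Longrightarrow> fps_eval N fps_X z = z"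
proof -
  assume z: "z ^ N = 0"
  have "fps_eval N fps_X z = (\<Sum>k<N. if k = 1 then z else 0)"
    unfolding fps_eval_def by (intro sum.cong) auto
  also have "\<dots> = z"
  proof (cases "N > 1")
    \<comment> \<open>For N at most 1 the sum misses the linear term, but then z^N = 0 leaves only z
      = 0.\<close>
    case False
    then have "N = 0 \<or> N = 1" by auto
    then show ?thesis using z by auto
  qed simp
  finally show ?thesis .
qed

lemma fps_eval_mult:
  assumes z: "z ^ N = 0"
  shows "fps_eval N (f * g) z = fps_eval N f z * fps_eval N g z"
proof -
  let ?t = "\<lambda>i j. scale (fps_nth f i * fps_nth g j) (z ^ (i + j))"
  have "fps_eval N f z * fps_eval N g z = (\<Sum>i<N. \<Sum>j<N. ?t i j)"
    by (simp add: fps_eval_def sum_product mult_scale power_add mult.commute flip: scale_mult)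
  also have "\<dots> = (\<Sum>(i, j)\<in>{..<N} \<times> {..<N}. ?t i j)"
    by (simp add: sum.cartesian_product)
  \<comment> \<open>Outside the triangle z^(i + j) is zero; inside it the terms form the Cauchy
    product.\<close>
  also have "\<dots> = (\<Sum>(i, j)\<in>{(i, j). i + j < N}. ?t i j)"
    by (rule sum.mono_neutral_right) (auto, metis power_eq_0_mono[OF z] not_le)
  also have "\<dots> = (\<Sum>k<N. \<Sum>i\<le>k. ?t i (k - i))"
    by (rule sum.triangle_reindex)
  also have "\<dots> = fps_eval N (f * g) z"
    by (simp add: fps_eval_def fps_mult_nth scale_sum_left atMost_atLeast0)
  finally show ?thesis ..
qed

lemma fps_eval_power: "z ^ N = 0 \<Longrightarrow> fps_eval N (f ^ k) z = fps_eval N f z ^ k"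
proof (induction k)
  case 0
  then show ?case by (cases "N = 0") (auto simp: fps_eval_1)
qed (simp add: fps_eval_mult)

text \<open>The series f^N starts in degree N at the earliest, and the truncation sees nothing from
  there on.\<close>

lemma fps_eval_nilpotent:
  assumes "z ^ N = 0" "fps_nth f 0 = 0"
  shows "fps_eval N f z ^ N = 0"
proof -
  have "fps_eval N (f ^ N) z = 0"
    using startsby_zero_power_prefix[OF assms(2), of N] by (simp add: fps_eval_def)
  then show ?thesis by (simp add: fps_eval_power[OF assms(1)])
qed

lemma fps_eval_compose:
  assumes z: "z ^ N = 0" and g: "fps_nth g 0 = 0"
  shows "fps_eval N (f oo g) z = fps_eval N f (fps_eval N g z)"
proof -
  \<comment> \<open>Since g^i has no coefficients below i, the inner sum over i up to n extends to
    all i < N, and the sums can be exchanged.\<close>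
  have "fps_eval N (f oo g) z =
      (\<Sum>n<N. \<Sum>i<N. scale (fps_nth f i * fps_nth (g ^ i) n) (z ^ n))"
    unfolding fps_eval_def fps_compose_nth scale_sum_left
    by (intro sum.cong sum.mono_neutral_left)
       (auto simp: startsby_zero_power_prefix[OF g] not_le)
  also have "\<dots> = (\<Sum>i<N. scale (fps_nth f i) (fps_eval N (g ^ i) z))"
    by (subst sum.swap) (simp add: fps_eval_def scale_sum_right)
  finally show ?thesis
    by (simp add: fps_eval_power[OF z]) (simp add: fps_eval_def)
qed

section \<open>Exponential and logarithm of nilpotent elements\<close>

lemma nilp_exp_eq_sum:
  assumes "u ^ N = 0"
  shows "nilp_exp scale u = (\<Sum>k<N. scale (inverse (fact k)) (u ^ k))"
  unfolding nilp_exp_def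
proof (rule sum.mono_neutral_left)
  show "{k. u ^ k \<noteq> 0} \<subseteq> {..<N}"
    using power_eq_0_mono[OF assms] not_le by blast
qed auto

text \<open>Splitting off 1 leaves a series without constant term, the form required for composition
  with \<open>fps_ln 1\<close>.\<close>

lemma nilp_exp_eq_fps_eval:
  assumes "u ^ N = 0"
  shows "nilp_exp scale u = 1 + fps_eval N (fps_exp 1 - 1) u"
proof -
  have "nilp_exp scale u = fps_eval N (1 + (fps_exp 1 - 1)) u"
    by (simp add: nilp_exp_eq_sum[OF assms] fps_eval_def divide_inverse)
  moreover have "N \<noteq> 0" using assms by (auto intro: gr0I)
  ultimately show ?thesis by (simp only: fps_eval_add fps_eval_1)
qed

text \<open>\<open>fps_ln 1\<close> is the series of ln (1 + X), so the argument m stands for the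
  unit 1 + m.\<close>

definition nilp_log :: "nat \<Rightarrow> 'a \<Rightarrow> 'a" where
  "nilp_log N m = fps_eval N (fps_ln 1) m"

lemma nilp_log_exp:
  assumes "u ^ N = 0"
  shows "nilp_log N (nilp_exp scale u - 1) = u"
proof -
  have "fps_ln 1 oo (fps_exp 1 - 1) = (fps_X :: 'k fps)"
    by (simp add: fps_ln_fps_exp_inv fps_inv_fps_exp_compose)
  then show ?thesis
    using fps_eval_compose[OF assms, of "fps_exp 1 - 1" "fps_ln 1"] fps_eval_X[OF assms]
    by (simp add: nilp_log_def nilp_exp_eq_fps_eval[OF assms])
qed

lemma nilp_exp_log:
  assumes "m ^ N = 0"
  shows "nilp_exp scale (nilp_log N m) = 1 + m"
proof -
  have "nilp_log N m ^ N = 0"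
    unfolding nilp_log_def by (rule fps_eval_nilpotent[OF assms]) simp
  moreover have "(fps_exp 1 - 1) oo fps_ln 1 = (fps_X :: 'k fps)"
    by (simp add: fps_ln_fps_exp_inv fps_inv_fps_exp_compose)
  ultimately show ?thesis
    using fps_eval_compose[OF assms, of "fps_ln 1" "fps_exp 1 - 1"] fps_eval_X[OF assms]
    by (simp add: nilp_log_def nilp_exp_eq_fps_eval)
qed

lemma nilp_exp_add:
  assumes u: "u ^ N = 0" and v: "v ^ N = 0" and uv: "(u + v) ^ N = 0"
  shows "nilp_exp scale (u + v) = nilp_exp scale u * nilp_exp scale v"
proof -
  \<comment> \<open>With i + j at least 2N, one of i and j is at least N, so all terms outside the
    triangle vanish.\<close>
  let ?M = "2 * N"
  let ?t = "\<lambda>i j. scale (inverse (fact i) * inverse (fact j)) (u ^ i * v ^ j)"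
  have "nilp_exp scale u * nilp_exp scale v = (\<Sum>i<?M. \<Sum>j<?M. ?t i j)"
    using power_eq_0_mono[OF u, of ?M] power_eq_0_mono[OF v, of ?M]
    by (simp add: nilp_exp_eq_sum[where N="?M"] sum_product mult_scale mult.commute flip: scale_mult)
  also have "\<dots> = (\<Sum>(i, j)\<in>{..<?M} \<times> {..<?M}. ?t i j)"
    by (simp add: sum.cartesian_product)
  also have "\<dots> = (\<Sum>(i, j)\<in>{(i, j). i + j < ?M}. ?t i j)"
  proof -
    have "?t i j = 0" if "\<not> i + j < ?M" for i j
    proof -
      have "N \<le> i \<or> N \<le> j" using that by linarith
      then have "u ^ i * v ^ j = 0"
        using power_eq_0_mono[OF u] power_eq_0_mono[OF v] by auto
      then show ?thesis by simp
    qed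
    then show ?thesis by (intro sum.mono_neutral_right) (auto, blast)
  qed
  also have "\<dots> = (\<Sum>k<?M. \<Sum>i\<le>k. ?t i (k - i))"
    by (rule sum.triangle_reindex)
  also have "\<dots> = (\<Sum>k<?M. scale (inverse (fact k)) ((u + v) ^ k))"
  proof (rule sum.cong)
    fix k
    have "?t i (k - i) = scale (inverse (fact k)) (of_nat (k choose i) * u ^ i * v ^ (k - i))"
      if "i \<le> k" for i
      using that by (simp add: mult.assoc of_nat_mult_eq_scale mult_scale binomial_fact field_simps)
    then show "(\<Sum>i\<le>k. ?t i (k - i)) = scale (inverse (fact k)) ((u + v) ^ k)"
      by (simp add: binomial_ring scale_sum_right)
  qed simp
  also have "\<dots> = nilp_exp scale (u + v)"
    using power_eq_0_mono[OF uv, of ?M] by (simp add: nilp_exp_eq_sum[where N="?M"])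
  finally show ?thesis ..
qed

text \<open>As a polynomial in t the hypothesis vanishes identically, so each coefficient does. The
  coefficient of t^j is the claimed value times a binomial coefficient, which is invertible in
  characteristic zero.\<close>

lemma functional_polarization:
  assumes l: "Vector_Spaces.linear scale (*) l"
    and 0: "\<And>t. l ((x + scale t y) ^ k) = 0" and "j \<le> k"
  shows "l (x ^ (k - j) * y ^ j) = 0"
proof -
  interpret l: Vector_Spaces.linear scale "(*)" l by fact
  let ?c = "\<lambda>i. of_nat (k choose i) * l (x ^ (k - i) * y ^ i)"
  have "poly (\<Sum>i\<le>k. monom (?c i) i) t = l ((x + scale t y) ^ k)" for t
  proof -
    have "(x + scale t y) ^ k = (\<Sum>i\<le>k. scale (of_nat (k choose i) * t ^ i) (x ^ (k - i) * y ^ i))"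
      unfolding add.commute[of x] binomial_ring
    proof (rule sum.cong)
      fix i
      have "of_nat (k choose i) * scale t y ^ i * x ^ (k - i) =
          of_nat (k choose i) * scale (t ^ i) (x ^ (k - i) * y ^ i)"
        by (simp only: scale_power mult.assoc scale_mult[symmetric]) (simp only: mult.commute)
      then show "of_nat (k choose i) * scale t y ^ i * x ^ (k - i) =
          scale (of_nat (k choose i) * t ^ i) (x ^ (k - i) * y ^ i)"
        by (simp only: of_nat_mult_eq_scale scale_scale)
    qed simp
    then show ?thesis by (simp add: poly_sum poly_monom l.sum l.scale mult_ac)
  qed
  then have "(\<Sum>i\<le>k. monom (?c i) i) = 0"
    using 0 by (simp add: poly_eq_poly_eq_iff[symmetric] fun_eq_iff)
  then have "coeff (\<Sum>i\<le>k. monom (?c i) i) j = 0" by simp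
  then have "?c j = 0" using \<open>j \<le> k\<close> by (simp add: coeff_sum)
  then show ?thesis using \<open>j \<le> k\<close> by simp
qed

end

section \<open>Local algebras\<close>

locale fin_dim_comm_algebra = comm_algebra scale + finite_dimensional_vector_space scale Basis
  for scale :: "'k::field_char_0 \<Rightarrow> 'a::comm_ring_1 \<Rightarrow> 'a" and Basis :: "'a set"
begin

lemma ring_ideal_iff:
  fixes J :: "'a set"
  shows "ring_ideal J \<longleftrightarrow> 0 \<in> J \<and> (\<forall>x\<in>J. \<forall>y\<in>J. x + y \<in> J) \<and> (\<forall>c. \<forall>x\<in>J. c * x \<in> J)"
proof -
  have "module ((*) :: 'a \<Rightarrow> 'a \<Rightarrow> 'a)" by unfold_locales (simp_all add: algebra_simps)
  then show ?thesis unfolding ring_ideal_def by (subst module.subspace_def) auto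
qed

lemma ring_ideal_subspace: "ring_ideal J \<Longrightarrow> subspace J"
  unfolding ring_ideal_iff subspace_def by (metis mult_1 scale_mult)

text \<open>Ideals are subspaces, so a proper ideal of greatest dimension above J is maximal; finite
  dimension takes the place of Zorn's lemma.\<close>

lemma exists_max_ideal:
  fixes J :: "'a set"
  assumes "ring_ideal J" "J \<noteq> UNIV"
  shows "\<exists>M. max_ideal M \<and> J \<subseteq> M"
proof -
  let ?P = "\<lambda>I :: 'a set. ring_ideal I \<and> J \<subseteq> I \<and> I \<noteq> UNIV"
  obtain M where M: "?P M" "\<And>I. ?P I \<Longrightarrow> dim I \<le> dim M"
    using ex_has_greatest_nat[of ?P J dim "Suc dimension"] assms dim_subset_UNIV
    by (metis (no_types, lifting) le_imp_less_Suc order_refl)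
  have "I = M \<or> I = UNIV" if "ring_ideal I" "M \<subseteq> I" for I
    using that M subspace_dim_equal[of M I] ring_ideal_subspace by blast
  then show ?thesis using M(1) unfolding max_ideal_def by blast
qed

context
  fixes \<mm> :: "'a set"
  assumes max: "{J. max_ideal J} = {\<mm>}"
begin

lemma max_ideal_props:
  "ring_ideal \<mm>" "subspace \<mm>" "x \<in> \<mm> \<Longrightarrow> c * x \<in> \<mm>" "1 \<notin> \<mm>"
proof -
  have m: "max_ideal \<mm>" using max by blast
  then show *: "ring_ideal \<mm>" by (simp add: max_ideal_def)
  then show "subspace \<mm>" by (rule ring_ideal_subspace)
  show cm: "c * x \<in> \<mm>" if "x \<in> \<mm>" for c x using * that by (simp add: ring_ideal_iff)
  show "1 \<notin> \<mm>"
  proof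
    assume "1 \<in> \<mm>"
    then have "\<mm> = UNIV" using cm[of 1] by auto
    then show False using m by (simp add: max_ideal_def)
  qed
qed

text \<open>Otherwise the multiples of 1 - z form a proper ideal, contained in \<open>\<mm>\<close>,
  and 1 = (1 - z) + z would lie in \<open>\<mm>\<close>.\<close>

lemma one_minus_max_ideal_unit:
  assumes "z \<in> \<mm>"
  shows "\<exists>y. (1 - z) * y = 1"
proof (rule ccontr)
  assume "\<nexists>y. (1 - z) * y = 1"
  then have "range ((*) (1 - z)) \<noteq> UNIV" by (metis UNIV_I image_iff)
  moreover have "ring_ideal (range ((*) (1 - z)))"
    unfolding ring_ideal_iff
  proof (intro conjI ballI allI)
    show "0 \<in> range ((*) (1 - z))" by (metis mult_zero_right rangeI)
    show "x + y \<in> range ((*) (1 - z))" if "x \<in> range ((*) (1 - z))" "y \<in> range ((*) (1 - z))" for x y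
      using that by (auto simp flip: distrib_left)
    show "c * x \<in> range ((*) (1 - z))" if "x \<in> range ((*) (1 - z))" for c x
      using that by (metis image_iff mult.left_commute rangeI)
  qed
  ultimately have "range ((*) (1 - z)) \<subseteq> \<mm>" using exists_max_ideal max by blast
  then have "1 - z \<in> \<mm>" by (metis mult.right_neutral range_subsetD)
  then show False using assms subspace_add[OF max_ideal_props(2), of "1 - z" z] max_ideal_props(4) by simp
qed

text \<open>The ideals generated by the powers of z lose dimension at each step until they vanish:
  if one step is stationary, then z^k = z^(k+1) a, hence z^k (1 - a z) = 0 with 1 - a z a
  unit.\<close>

lemma max_ideal_nilpotent:
  assumes "z \<in> \<mm>"
  shows "z ^ Suc dimension = 0"
proof -
  let ?I = "\<lambda>k. range ((*) (z ^ k))"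
  have sub: "subspace (?I k)" for k
    unfolding subspace_def
    by (auto simp flip: distrib_left mult_scale) (metis mult_zero_right rangeI)
  have "z ^ k = 0 \<or> dim (?I k) + k \<le> dimension" for k
  proof (induction k)
    case 0
    then show ?case by (simp add: dimension_def)
  next
    case (Suc k)
    show ?case
    proof (cases "z ^ Suc k = 0")
      case False
      have le: "?I (Suc k) \<subseteq> ?I k" by (intro image_subsetI) (metis power_Suc2 mult.assoc rangeI)
      have "dim (?I (Suc k)) < dim (?I k)"
      proof (rule ccontr)
        assume "\<not> dim (?I (Suc k)) < dim (?I k)"
        then have "?I (Suc k) = ?I k" using subspace_dim_equal[OF sub sub le] by simp
        then obtain a where a: "z ^ k = z ^ Suc k * a" by (metis image_iff mult.right_neutral rangeI)
        have "a * z \<in> \<mm>" using assms by (rule max_ideal_props)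
        then obtain y where "(1 - a * z) * y = 1" using one_minus_max_ideal_unit by blast
        then have "z ^ k = z ^ k * (1 - a * z) * y" by (simp add: mult.assoc)
        also have "z ^ k * (1 - a * z) = 0" using a by (simp add: algebra_simps)
        finally show False using False by simp
      qed
      then show ?thesis using Suc False by auto
    qed simp
  qed
  from this[of "Suc dimension"] show ?thesis by simp
qed

end

section \<open>Functionals that cut out subspaces\<close>

lemma exists_functional:
  assumes "subspace S" "v \<notin> S"
  shows "\<exists>l. Vector_Spaces.linear scale (*) l \<and> (\<forall>x\<in>S. l x = 0) \<and> l v = 1"
proof -
  have pair: "vector_space_pair scale ((*) :: 'k \<Rightarrow> 'k \<Rightarrow> 'k)"
    by (intro vector_space_pair.intro vector_space_axioms vector_space_over_itself.vector_space_axioms)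
  obtain B where B: "B \<subseteq> S" "independent B" "S \<subseteq> span B"
    by (rule basis_exists[of S]) (rule that)
  then have "span B = S" using span_minimal[OF B(1) assms(1)] by blast
  then have "independent (insert v B)" using B assms by (simp add: independent_insertI)
  then obtain l where l: "Vector_Spaces.linear scale (*) l"
      "\<forall>x\<in>insert v B. l x = (if x = v then 1 else 0)"
    using vector_space_pair.linear_independent_extend
      [OF pair, of "insert v B" "\<lambda>x. if x = v then 1 else 0"] by blast
  interpret l: Vector_Spaces.linear scale "(*)" l by fact
  have "l x = 0" if "x \<in> B" for x using l(2) B(1) assms(2) that by auto
  then have "l x = 0" if "x \<in> S" for x
    using that \<open>span B = S\<close> by (intro l.eq_0_on_span[of B x]) auto
  then show ?thesis using l by auto
qed

text \<open>By dimension W is U plus the multiples of v, and l reads off the coefficient of v.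
  Serves for U in \<open>\<mm>\<close> and for \<open>\<mm>\<close> in the whole algebra.\<close>

lemma hyperplane_functional:
  assumes "subspace U" "U \<subseteq> W" "dim W = dim U + 1" "subspace W" "v \<in> W" "v \<notin> U"
    "\<forall>x\<in>U. l x = 0" "l v = (1::'k)" "Vector_Spaces.linear scale (*) l"
  shows "x \<in> U \<longleftrightarrow> x \<in> W \<and> l x = 0"
proof -
  interpret l: Vector_Spaces.linear scale "(*)" l by fact
  have U: "span U = U" using assms(1) by simp
  have "span (insert v U) = W"
  proof (rule subspace_dim_equal)
    show "span (insert v U) \<subseteq> W" using assms by (intro span_minimal) auto
    have "dim (insert v U) = dim U + 1" using dim_insert[of v U] assms(6) by (simp only: U if_False)
    then show "dim W \<le> dim (span (insert v U))" using assms(3) by simp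
  qed (use assms in auto)
  then have "x \<in> U" if "x \<in> W" "l x = 0"
  proof -
    have "x \<in> span (insert v U)" using that(1) \<open>span (insert v U) = W\<close> by simp
    then obtain c where c: "x - scale c v \<in> U" unfolding span_breakdown_eq U by blast
    then have "l (x - scale c v) = 0" using assms(7) by blast
    then have "c = 0" using that(2) assms(8) by (simp add: l.diff l.scale)
    then show "x \<in> U" using c by simp
  qed
  then show ?thesis using assms(2,7) by blast
qed

end

section \<open>Coordinates on an H-pair\<close>

text \<open>\<open>\<pi>\<close> cuts out \<open>U\<close> in \<open>\<mm>\<close>, \<open>\<epsilon>\<close> is the residue map, and \<open>d\<close> turns out to be the degree of
  the hypersurface. By polarization, \<open>d\<close> is the greatest integer with \<open>\<mm>\<^sup>d\<close> not contained in \<open>U\<close>.\<close>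

locale H_pair_coordinates = comm_algebra scale
  for scale :: "'k::{alg_closed_field, field_char_0} \<Rightarrow> 'a::comm_ring_1 \<Rightarrow> 'a" +
  fixes \<mm> U :: "'a set" and \<pi> \<epsilon> :: "'a \<Rightarrow> 'k" and N d :: nat and v b :: 'a
  assumes \<pi>: "Vector_Spaces.linear scale (*) \<pi>" and \<epsilon>: "Vector_Spaces.linear scale (*) \<epsilon>"
    and \<epsilon>_1: "\<epsilon> 1 = 1" and mem_m_iff: "x \<in> \<mm> \<longleftrightarrow> \<epsilon> x = 0"
    and mem_U_iff: "x \<in> U \<longleftrightarrow> x \<in> \<mm> \<and> \<pi> x = 0"
    and m_ideal: "x \<in> \<mm> \<Longrightarrow> y * x \<in> \<mm>"
    and m_nilpotent: "x \<in> \<mm> \<Longrightarrow> x ^ N = 0"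
    and v: "v \<in> \<mm>" "\<pi> v = 1"
    and d_ge_2: "d \<ge> 2"
    and \<pi>_power: "x \<in> \<mm> \<Longrightarrow> k > d \<Longrightarrow> \<pi> (x ^ k) = 0"
    and b: "b \<in> \<mm>" "\<pi> (b ^ d) \<noteq> 0"
begin

sublocale \<pi>: Vector_Spaces.linear scale "(*)" \<pi> by (rule \<pi>)
sublocale \<epsilon>: Vector_Spaces.linear scale "(*)" \<epsilon> by (rule \<epsilon>)

lemma m_add: "x \<in> \<mm> \<Longrightarrow> y \<in> \<mm> \<Longrightarrow> x + y \<in> \<mm>"
  and m_diff: "x \<in> \<mm> \<Longrightarrow> y \<in> \<mm> \<Longrightarrow> x - y \<in> \<mm>"
  and m_scale: "x \<in> \<mm> \<Longrightarrow> scale c x \<in> \<mm>"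
  and m_0: "0 \<in> \<mm>"
  by (simp_all add: mem_m_iff \<epsilon>.add \<epsilon>.diff \<epsilon>.scale)

lemma exp_minus_1_in_m: "x \<in> \<mm> \<Longrightarrow> nilp_exp scale x - 1 \<in> \<mm>"
proof -
  assume x: "x \<in> \<mm>"
  have "nilp_exp scale x - 1 = fps_eval N (fps_exp 1 - 1) x"
    using nilp_exp_eq_fps_eval[OF m_nilpotent[OF x]] by simp
  also have "\<dots> \<in> \<mm>"
    unfolding fps_eval_def mem_m_iff \<epsilon>.sum \<epsilon>.scale
  proof (rule sum.neutral, rule ballI)
    fix k
    show "fps_nth (fps_exp 1 - 1) k * \<epsilon> (x ^ k) = 0"
    proof (cases k)
      case (Suc j)
      then show ?thesis using m_ideal[OF x, of "x ^ j"] by (simp add: mem_m_iff mult.commute)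
    qed simp
  qed
  finally show ?thesis .
qed

lemma \<epsilon>_exp: "x \<in> \<mm> \<Longrightarrow> \<epsilon> (nilp_exp scale x) = 1"
  using exp_minus_1_in_m[of x] by (simp add: mem_m_iff \<epsilon>.diff \<epsilon>_1)

lemma log_in_m: "x \<in> \<mm> \<Longrightarrow> nilp_log N x \<in> \<mm>"
  unfolding nilp_log_def fps_eval_def mem_m_iff \<epsilon>.sum \<epsilon>.scale
proof (rule sum.neutral, rule ballI)
  fix k assume x: "\<epsilon> x = 0"
  show "fps_nth (fps_ln 1) k * \<epsilon> (x ^ k) = 0"
  proof (cases k)
    case (Suc j)
    then show ?thesis using m_ideal[of x "x ^ j"] x by (simp add: mem_m_iff mult.commute)
  qed simp
qed

lemma exp_surj:
  assumes "\<epsilon> x \<noteq> 0"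
  obtains y where "y \<in> \<mm>" "x = scale (\<epsilon> x) (nilp_exp scale y)"
proof -
  let ?m = "scale (inverse (\<epsilon> x)) x - 1"
  have m: "?m \<in> \<mm>" using assms by (simp add: mem_m_iff \<epsilon>.diff \<epsilon>.scale \<epsilon>_1)
  show thesis
  proof
    show "nilp_log N ?m \<in> \<mm>" using m by (rule log_in_m)
    show "x = scale (\<epsilon> x) (nilp_exp scale (nilp_log N ?m))"
      using nilp_exp_log[OF m_nilpotent[OF m]] assms by simp
  qed
qed

text \<open>The homogenization of \<open>\<pi> (ln (1 + m))\<close>.\<close>

definition F :: "'a \<Rightarrow> 'k" where
  "F x = (\<Sum>k=1..d. fps_nth (fps_ln 1) k * (\<epsilon> x ^ (d - k) * \<pi> ((x - scale (\<epsilon> x) 1) ^ k)))"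

lemma F_on_m:
  assumes "x \<in> \<mm>"
  shows "F x = fps_nth (fps_ln 1) d * \<pi> (x ^ d)"
proof -
  \<comment> \<open>With \<open>\<epsilon> x = 0\<close> the factor
    \<open>\<epsilon> x ^ (d - k)\<close> survives only for k = d, where it is 0^0 = 1.\<close>
  have "F x = (\<Sum>k=1..d. if k = d then fps_nth (fps_ln 1) d * \<pi> (x ^ d) else 0)"
    unfolding F_def using assms by (intro sum.cong) (auto simp: mem_m_iff)
  then show ?thesis using d_ge_2 by simp
qed

lemma F_on_m_eq_0_iff: "x \<in> \<mm> \<Longrightarrow> F x = 0 \<longleftrightarrow> \<pi> (x ^ d) = 0"
  using d_ge_2 by (simp add: F_on_m fps_ln_nth)

lemma F_exp:
  assumes "y \<in> \<mm>"
  shows "F (scale c (nilp_exp scale y)) = c ^ d * \<pi> y"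
proof -
  let ?m = "nilp_exp scale y - 1"
  let ?f = "\<lambda>k. fps_nth (fps_ln 1) k * \<pi> (?m ^ k)"
  have m: "?m \<in> \<mm>" using assms by (rule exp_minus_1_in_m)
  have *: "scale c (nilp_exp scale y) - scale c 1 = scale c ?m"
    by (simp add: scale_right_diff_distrib)
  have "F (scale c (nilp_exp scale y)) =
      (\<Sum>k=1..d. fps_nth (fps_ln 1) k * (c ^ (d - k) * (c ^ k * \<pi> (?m ^ k))))"
    by (simp add: F_def \<epsilon>.scale \<epsilon>_exp[OF assms] * scale_power \<pi>.scale)
  also have "\<dots> = (\<Sum>k=1..d. c ^ d * ?f k)"
    by (intro sum.cong) (auto simp flip: mult.assoc power_add)
  also have "\<dots> = c ^ d * (\<Sum>k=1..d. ?f k)" by (simp add: sum_distrib_left)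
  \<comment> \<open>The aim is the range k < N of \<open>nilp_log\<close>. The term k = 0 has
    coefficient 0, those above d are killed by \<open>\<pi>\<close>, those from N on by nilpotency;
    the maximum avoids comparing d with N.\<close>
  also have "(\<Sum>k=1..d. ?f k) = (\<Sum>k<max N (Suc d). ?f k)"
  proof (rule sum.mono_neutral_left)
    show "\<forall>k\<in>{..<max N (Suc d)} - {1..d}. ?f k = 0"
    proof
      fix k assume "k \<in> {..<max N (Suc d)} - {1..d}"
      then have "k = 0 \<or> k > d" by auto
      then show "?f k = 0" using \<pi>_power[OF m] by auto
    qed
  qed auto
  also have "\<dots> = (\<Sum>k<N. ?f k)"
    using power_eq_0_mono[OF m_nilpotent[OF m]]
    by (intro sum.mono_neutral_right) (auto simp: not_less)
  also have "\<dots> = \<pi> (nilp_log N ?m)"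
    by (simp add: nilp_log_def fps_eval_def \<pi>.sum \<pi>.scale)
  also have "\<dots> = \<pi> y" by (simp add: nilp_log_exp[OF m_nilpotent[OF assms]])
  finally show ?thesis .
qed

lemma F_eq_0_imp_in_exp_cone:
  assumes "F x = 0" "x \<notin> \<mm>"
  obtains c u where "c \<noteq> 0" "u \<in> U" "x = scale c (nilp_exp scale u)"
proof -
  have "\<epsilon> x \<noteq> 0" using assms(2) mem_m_iff by blast
  moreover from this obtain y where y: "y \<in> \<mm>" "x = scale (\<epsilon> x) (nilp_exp scale y)"
    by (rule exp_surj)
  moreover have "\<pi> y = 0" using F_exp[OF y(1), of "\<epsilon> x"] y(2) assms(1) \<open>\<epsilon> x \<noteq> 0\<close> by simp
  ultimately show thesis using that mem_U_iff by blast
qed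

lemma F_scale:
  assumes "F x = 0"
  shows "F (scale c x) = 0"
proof (cases "x \<in> \<mm>")
  case True
  then show ?thesis
    using assms by (simp add: F_on_m_eq_0_iff m_scale scale_power \<pi>.scale)
next
  case False
  then obtain a u where "u \<in> U" "x = scale a (nilp_exp scale u)"
    using F_eq_0_imp_in_exp_cone[OF assms] by blast
  then show ?thesis using F_exp[of u "c * a"] by (simp add: mem_U_iff)
qed

text \<open>The algebra carries no coordinates here, so polynomial dependence on t is tested by all
  functionals.\<close>

definition poly_curve :: "('k \<Rightarrow> 'a) \<Rightarrow> bool" where
  "poly_curve \<gamma> \<longleftrightarrow> (\<forall>l. Vector_Spaces.linear scale (*) l \<longrightarrow> (\<exists>Q. \<forall>t. l (\<gamma> t) = poly Q t))"

lemma poly_curve_line_power: "poly_curve (\<lambda>t. (x + scale t y) ^ k)"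
proof (induction k)
  case 0
  show ?case unfolding poly_curve_def
  proof (intro allI impI)
    fix l :: "'a \<Rightarrow> 'k"
    show "\<exists>Q. \<forall>t. l ((x + scale t y) ^ 0) = poly Q t" by (rule exI[of _ "[:l 1:]"]) simp
  qed
next
  case (Suc k)
  show ?case unfolding poly_curve_def
  proof (intro allI impI)
    fix l assume l: "Vector_Spaces.linear scale (*) l"
    interpret l: Vector_Spaces.linear scale "(*)" l by fact
    obtain P Q where "\<And>t. l (x * (x + scale t y) ^ k) = poly P t"
        "\<And>t. l (y * (x + scale t y) ^ k) = poly Q t"
      using Suc linear_mult[OF l] unfolding poly_curve_def by meson
    then have "l ((x + scale t y) ^ Suc k) = poly (P + [:0, 1:] * Q) t" for t
      by (simp add: distrib_right l.add l.scale flip: scale_mult)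
    then show "\<exists>Q. \<forall>t. l ((x + scale t y) ^ Suc k) = poly Q t" by blast
  qed
qed

lemma poly_curve_line: "poly_curve (\<lambda>t. x + scale t y)"
  using poly_curve_line_power[of x y 1] by simp

lemma poly_curve_exp:
  assumes "x \<in> \<mm>" "y \<in> \<mm>"
  shows "poly_curve (\<lambda>t. scale c (nilp_exp scale (x + scale t y)))"
  unfolding poly_curve_def
proof (intro allI impI)
  fix l assume l: "Vector_Spaces.linear scale (*) l"
  interpret l: Vector_Spaces.linear scale "(*)" l by fact
  have "\<exists>Q. \<forall>t. l ((x + scale t y) ^ k) = poly Q t" for k
    using poly_curve_line_power[of x y k] l unfolding poly_curve_def by blast
  then obtain Q where Q: "\<And>k t. l ((x + scale t y) ^ k) = poly (Q k) t" by metis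
  \<comment> \<open>One N serves for all t, so the length of the exponential sum does not vary along
    the curve.\<close>
  have "(x + scale t y) ^ N = 0" for t using assms m_add m_scale m_nilpotent by blast
  then have "nilp_exp scale (x + scale t y) =
      (\<Sum>k<N. scale (inverse (fact k)) ((x + scale t y) ^ k))" for t
    by (rule nilp_exp_eq_sum)
  then have "l (scale c (nilp_exp scale (x + scale t y))) =
      poly (smult c (\<Sum>k<N. smult (inverse (fact k)) (Q k))) t" for t
    by (simp add: l.scale l.sum Q poly_sum)
  then show "\<exists>Q. \<forall>t. l (scale c (nilp_exp scale (x + scale t y))) = poly Q t" by blast
qed

text \<open>An equation of the closure of the exponential cone divides \<open>F\<close>. On the curves
  \<open>t \<mapsto> c exp(u + tv)\<close> the polynomial \<open>F\<close> is \<open>c\<^sup>d t\<close>, so that the cofactor has no zeros outside \<open>\<mm>\<close>.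
  It is then constant on lines from \<open>c\<close> in the direction of \<open>\<mm>\<close>, hence constant on \<open>\<mm>\<close>.\<close>

lemma F_factor_on_m:
  assumes fac: "\<And>x. F x = g x * h x"
    and g: "\<And>\<gamma>. poly_curve \<gamma> \<Longrightarrow> \<exists>Q. \<forall>t. g (\<gamma> t) = poly Q t"
    and h: "\<And>\<gamma>. poly_curve \<gamma> \<Longrightarrow> \<exists>Q. \<forall>t. h (\<gamma> t) = poly Q t"
    and g0: "\<And>c u. c \<noteq> 0 \<Longrightarrow> u \<in> U \<Longrightarrow> g (scale c (nilp_exp scale u)) = 0"
    and x: "x \<in> \<mm>"
  shows "g x = 0 \<longleftrightarrow> \<pi> (x ^ d) = 0"
proof -
  have h_nz: "h y \<noteq> 0" if nz: "\<epsilon> y \<noteq> 0" for y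
  proof -
    obtain m where m: "m \<in> \<mm>" "y = scale (\<epsilon> y) (nilp_exp scale m)"
      using exp_surj[OF nz] by blast
    \<comment> \<open>Removing the v-component moves m into U, and y becomes the point of the curve
      at the parameter \<open>\<pi> m\<close>.\<close>
    define u where "u = m - scale (\<pi> m) v"
    have u: "u \<in> U" using m(1) v by (simp add: u_def mem_U_iff m_diff m_scale \<pi>.diff \<pi>.scale)
    define \<gamma> where "\<gamma> = (\<lambda>t. scale (\<epsilon> y) (nilp_exp scale (u + scale t v)))"
    have "poly_curve \<gamma>" unfolding \<gamma>_def using u v by (intro poly_curve_exp) (auto simp: mem_U_iff)
    then obtain P Q where P: "\<And>t. g (\<gamma> t) = poly P t" and Q: "\<And>t. h (\<gamma> t) = poly Q t"
      using g h by metis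
    have "poly (P * Q) t = poly [:0, \<epsilon> y ^ d:] t" for t
      using F_exp[of "u + scale t v" "\<epsilon> y"] fac[of "\<gamma> t"] u v
      by (simp add: \<gamma>_def[symmetric] P Q mem_U_iff m_add m_scale \<pi>.add \<pi>.scale)
         (simp add: \<gamma>_def mult.commute)
    then have PQ: "P * Q = [:0, 1:] * [:\<epsilon> y ^ d:]"
      by (simp add: poly_eq_poly_eq_iff[symmetric] fun_eq_iff)
    \<comment> \<open>At t = 0 the curve meets the exponential cone, so g takes up the single factor
      t of the product and Q is left without zeros.\<close>
    have "poly P 0 = 0" using P[of 0] g0[OF nz u] by (simp add: \<gamma>_def)
    then obtain R where "P = [:0, 1:] * R" using poly_eq_0_iff_dvd[of P 0] by (auto elim: dvdE)
    then have "[:0, 1:] * (R * Q) = [:0, 1:] * [:\<epsilon> y ^ d:]" using PQ by (simp only: mult.assoc)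
    then have "R * Q = [:\<epsilon> y ^ d:]" by (subst (asm) mult_left_cancel) auto
    then have "poly (R * Q) (\<pi> m) = \<epsilon> y ^ d" by simp
    then have "poly Q (\<pi> m) \<noteq> 0" using nz by auto
    moreover have "\<gamma> (\<pi> m) = y" using m(2) by (simp add: \<gamma>_def u_def)
    ultimately show ?thesis using Q by metis
  qed
  have h_const: "h (scale a 1 + m) = h (scale a 1)" if "m \<in> \<mm>" "a \<noteq> 0" for a m
  proof -
    obtain Q where Q: "\<And>t. h (scale a 1 + scale t m) = poly Q t"
      using h[OF poly_curve_line] by blast
    have "poly Q t \<noteq> 0" for t
      using h_nz[of "scale a 1 + scale t m"] that Q[of t] by (simp add: mem_m_iff \<epsilon>.add \<epsilon>.scale \<epsilon>_1)
    then have "poly Q 1 = poly Q 0" by (rule alg_closed_rootless_constant)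
    then show ?thesis using Q[of 1] Q[of 0] by simp
  qed
  have h_m: "h m = h 0" if m: "m \<in> \<mm>" for m
  proof -
    \<comment> \<open>At a = 0 both points lie in \<open>\<mm>\<close>, where the zeros of h are not
      yet controlled; the equality is carried there from all a different from 0 as an identity of
      polynomials in a.\<close>
    obtain P Q where P: "\<And>a. h (m + scale a 1) = poly P a" and Q: "\<And>a. h (0 + scale a 1) = poly Q a"
      using h[OF poly_curve_line] by metis
    have "- {0} \<subseteq> {a. poly (P - Q) a = 0}"
      using h_const[OF m] P Q by (auto simp: add.commute)
    moreover have "infinite (- {0::'k})" using infinite_UNIV_char_0[where 'a='k] by simp
    ultimately have "infinite {a. poly (P - Q) a = 0}" using finite_subset by blast
    then have "P - Q = 0" using poly_roots_finite by blast
    then show ?thesis using P[of 0] Q[of 0] by simp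
  qed
  have "h 0 \<noteq> 0"
    using b F_on_m_eq_0_iff[of b] fac[of b] h_m[of b] by auto
  then show ?thesis using fac[of x] h_m[OF x] F_on_m_eq_0_iff[OF x] by auto
qed

lemma vertex: "\<exists>w\<in>\<mm>. w \<noteq> 0 \<and> (\<forall>z\<in>\<mm>. \<forall>t. \<pi> ((z + scale t w) ^ d) = \<pi> (z ^ d))"
proof (intro bexI conjI ballI allI)
  show "b ^ 2 \<noteq> 0"
  proof
    assume "b ^ 2 = 0"
    then have "b ^ d = 0" using d_ge_2 by (rule power_eq_0_mono)
    then show False using b(2) by simp
  qed
  show "b ^ 2 \<in> \<mm>" unfolding power2_eq_square using b(1) by (rule m_ideal)
  fix z t assume z: "z \<in> \<mm>"
  let ?c = "\<lambda>i. of_nat (d choose i) * t ^ i * \<pi> (z ^ (d - i) * b ^ (2 * i))"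
  have "\<pi> ((z + scale t (b ^ 2)) ^ d) = (\<Sum>i\<le>d. ?c i)"
    unfolding add.commute[of z] binomial_ring \<pi>.sum
  proof (rule sum.cong)
    fix i
    have "of_nat (d choose i) * scale t (b ^ 2) ^ i * z ^ (d - i) =
        of_nat (d choose i) * scale (t ^ i) (z ^ (d - i) * b ^ (2 * i))"
      by (simp only: scale_power mult.assoc scale_mult[symmetric] power_mult[symmetric])
         (simp only: mult.commute)
    then show "\<pi> (of_nat (d choose i) * scale t (b ^ 2) ^ i * z ^ (d - i)) = ?c i"
      by (simp only: of_nat_mult_eq_scale scale_scale \<pi>.scale)
  qed simp
  also have "\<dots> = (\<Sum>i\<le>d. if i = 0 then \<pi> (z ^ d) else 0)"
  proof (rule sum.cong)
    fix i assume i: "i \<in> {..d}"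
    show "?c i = (if i = 0 then \<pi> (z ^ d) else 0)"
    proof (cases "i = 0")
      case False
      \<comment> \<open>The exponent d - i is rewritten as d + i - 2 i to display a mixed term of a
        power d + i, which exceeds d because i is positive.\<close>
      have "\<pi> (z ^ (d + i - 2 * i) * b ^ (2 * i)) = 0"
      proof (rule functional_polarization[OF \<pi>])
        show "\<pi> ((z + scale t b) ^ (d + i)) = 0" for t
          using False z b(1) by (intro \<pi>_power m_add m_scale) auto
      qed (use i in simp)
      then show ?thesis using False i by simp
    qed simp
  qed simp
  finally show "\<pi> ((z + scale t (b ^ 2)) ^ d) = \<pi> (z ^ d)" by simp
qed

end

lemma exists_H_pair_coordinates:
  fixes scale :: "'k::{alg_closed_field, field_char_0} \<Rightarrow> 'a::comm_ring_1 \<Rightarrow> 'a"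
  assumes "fin_dim_comm_algebra scale B" and H: "H_pair scale \<mm> U"
    and codim: "vector_space.dim scale UNIV = vector_space.dim scale \<mm> + 1"
  shows "\<exists>\<pi> \<epsilon> N d v b. H_pair_coordinates scale \<mm> U \<pi> \<epsilon> N d v b"
proof -
  interpret fin_dim_comm_algebra scale B by fact
  have max: "{J. max_ideal J} = {\<mm>}" and U: "subspace U" "U \<subseteq> \<mm>" "dim \<mm> = dim U + 1"
    and gen: "\<And>S. subalgebra scale S \<Longrightarrow> U \<subseteq> S \<Longrightarrow> S = UNIV"
    using H by (simp_all add: H_pair_def local_algebra_def)
  note m = max_ideal_props[OF max]
  have nil: "x ^ k = 0" if "x \<in> \<mm>" "Suc dimension \<le> k" for x k
    using power_eq_0_mono[OF max_ideal_nilpotent[OF max that(1)] that(2)] .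
  have "U \<noteq> \<mm>" using U(3) by auto
  then obtain v where v: "v \<in> \<mm>" "v \<notin> U" using U(2) by blast
  have span_U: "span U = U" using U(1) by simp
  \<comment> \<open>Including 1 makes \<open>\<pi>\<close> vanish on the scalars, so that its kernel
    in the whole algebra can be a subalgebra below.\<close>
  have "v \<notin> span (insert 1 U)"
  proof
    assume "v \<in> span (insert 1 U)"
    then obtain c where c: "v - scale c 1 \<in> U" unfolding span_breakdown_eq span_U by blast
    then have "v - (v - scale c 1) \<in> \<mm>" using v(1) U(2) m(2) subspace_diff by blast
    then have "scale c 1 \<in> \<mm>" by simp
    then have "scale (inverse c) (scale c 1) \<in> \<mm>" using m(2) subspace_scale by blast
    then have "c = 0" using m(4) by (cases "c = 0") auto
    then show False using c v(2) by simp
  qed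
  then obtain \<pi> where \<pi>: "Vector_Spaces.linear scale (*) \<pi>"
      "\<forall>x\<in>span (insert 1 U). \<pi> x = 0" "\<pi> v = 1"
    using exists_functional[OF subspace_span] by blast
  have \<pi>_1: "\<pi> 1 = 0" and \<pi>_U: "\<forall>x\<in>U. \<pi> x = 0" using \<pi>(2) by (simp_all add: span_base)
  obtain \<epsilon> where \<epsilon>: "Vector_Spaces.linear scale (*) \<epsilon>" "\<forall>x\<in>\<mm>. \<epsilon> x = 0" "\<epsilon> 1 = 1"
    using exists_functional[OF m(2,4)] by blast
  interpret \<pi>: Vector_Spaces.linear scale "(*)" \<pi> by (rule \<pi>(1))
  interpret \<epsilon>: Vector_Spaces.linear scale "(*)" \<epsilon> by (rule \<epsilon>(1))
  have m_iff: "x \<in> \<mm> \<longleftrightarrow> \<epsilon> x = 0" for x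
    using hyperplane_functional[OF m(2) subset_UNIV codim subspace_UNIV UNIV_I m(4) \<epsilon>(2,3,1)] by simp
  have U_iff: "x \<in> U \<longleftrightarrow> x \<in> \<mm> \<and> \<pi> x = 0" for x
    using hyperplane_functional[OF U m(2) v \<pi>_U \<pi>(3,1)] .
  let ?P = "\<lambda>k. \<exists>z\<in>\<mm>. \<pi> (z ^ k) \<noteq> 0"
  have "?P 1" using v(1) \<pi>(3) by (intro bexI[of _ v]) auto
  \<comment> \<open>Nilpotency bounds the exponents, so a greatest one exists.\<close>
  moreover have "k < Suc dimension" if "?P k" for k
    using that nil[of _ k] by (metis \<pi>.zero not_less)
  ultimately obtain d where d: "?P d" "\<And>k. ?P k \<Longrightarrow> k \<le> d"
    using ex_has_greatest_nat[of ?P 1 "\<lambda>k. k" "Suc dimension"] by blast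
  have "d \<ge> 2"
  proof (rule ccontr)
    assume "\<not> d \<ge> 2"
    \<comment> \<open>If \<open>\<pi>\<close> kills all squares in \<open>\<mm>\<close>,
      polarization makes it kill all products of two elements. Its kernel is then a subalgebra
      containing U but not v, against the assumption that U generates.\<close>
    then have sq: "\<pi> (z ^ 2) = 0" if "z \<in> \<mm>" for z using d(2)[of 2] that by auto
    have prod: "\<pi> (x * y) = 0" if "x \<in> \<mm>" "y \<in> \<mm>" for x y
    proof -
      have "\<pi> (x ^ (2 - 1) * y ^ 1) = 0"
        using that m(2) by (intro functional_polarization[OF \<pi>(1)] sq subspace_add subspace_scale) auto
      then show ?thesis by simp
    qed
    have "subalgebra scale {a. \<pi> a = 0}"
      unfolding subalgebra_def
    proof (intro conjI ballI)
      show "subspace {a. \<pi> a = 0}"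
        by (simp add: subspace_def \<pi>.add \<pi>.scale)
      fix x y assume xy: "x \<in> {a. \<pi> a = 0}" "y \<in> {a. \<pi> a = 0}"
      let ?x = "x - scale (\<epsilon> x) 1" and ?y = "y - scale (\<epsilon> y) 1"
      have "\<pi> (?x * ?y) = 0" by (rule prod) (simp_all add: m_iff \<epsilon>.diff \<epsilon>.scale \<epsilon>(3))
      moreover have "?x * ?y = x * y - scale (\<epsilon> x) y - scale (\<epsilon> y) x + scale (\<epsilon> x * \<epsilon> y) 1"
        by (simp add: algebra_simps mult_scale flip: scale_mult)
      ultimately show "x * y \<in> {a. \<pi> a = 0}"
        using xy \<pi>_1 by (simp add: \<pi>.add \<pi>.diff \<pi>.scale)
    qed (simp add: \<pi>_1)
    then have "{a. \<pi> a = 0} = UNIV" using gen \<pi>_U by blast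
    then have "\<pi> v = 0" by blast
    then show False using \<pi>(3) by simp
  qed
  obtain b where b: "b \<in> \<mm>" "\<pi> (b ^ d) \<noteq> 0" using d(1) by blast
  have "H_pair_coordinates scale \<mm> U \<pi> \<epsilon> (Suc dimension) d v b"
  proof unfold_locales
    show "\<pi> (x ^ k) = 0" if "x \<in> \<mm>" "k > d" for x k using d(2)[of k] that by auto
    show "x ^ Suc dimension = 0" if "x \<in> \<mm>" for x using nil that by blast
  qed (use \<pi>(3) \<epsilon>(3) m_iff U_iff m(3) v(1) \<open>d \<ge> 2\<close> b in auto)
  then show ?thesis by blast
qed

section \<open>The boundary of the orbit\<close>

text \<open>That g generates the vanishing ideal is what turns the vanishing of F on X into
  divisibility by g.\<close>

locale H_pair_hypersurface = H_pair_coordinates scale \<mm> U \<pi> \<epsilon> N d v b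
  for scale :: "'k::{alg_closed_field, field_char_0} \<Rightarrow> 'a::comm_ring_1 \<Rightarrow> 'a"
    and \<mm> U \<pi> \<epsilon> N d v b +
  fixes \<phi> :: "'k ^ 'n::finite \<Rightarrow> 'a" and X :: "('k ^ 'n) set set"
    and \<alpha> :: "'k ^ 'g::finite \<Rightarrow> ('k ^ 'n) set \<Rightarrow> ('k ^ 'n) set" and g :: "('n, 'k) mpoly"
  assumes corr: "corresponds scale U \<phi> X \<alpha>"
    and g: "hypersurface_eq g X" and ideal_X: "vanishing_ideal X = range ((*) g)"
begin

lemma \<phi>_linear: "Vector_Spaces.linear (*s) scale \<phi>" and \<phi>_bij: "bij \<phi>"
  using corr by (auto simp: corresponds_def)

sublocale \<phi>: Vector_Spaces.linear "(*s)" scale \<phi> by (rule \<phi>_linear)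

lemma \<phi>_eq_0_iff: "\<phi> x = 0 \<longleftrightarrow> x = 0"
  using \<phi>_bij by (metis \<phi>.zero bij_pointE)

lemma \<phi>_inv: "\<phi> (inv \<phi> a) = a" "inv \<phi> (\<phi> x) = x"
  using \<phi>_bij by (simp_all add: bij_is_surj surj_f_inv_f bij_is_inj)

lemma \<phi>_pt: "\<phi> ` pt x = line scale (\<phi> x)"
  unfolding pt_def by (rule image_line[OF \<phi>_linear])

lemma \<phi>_image_inj: "\<phi> ` L = \<phi> ` L' \<Longrightarrow> L = L'"
  using \<phi>_bij by (simp add: bij_is_inj inj_image_eq_iff)

lemma peval_poly_curve:
  assumes "poly_curve \<gamma>"
  shows "\<exists>Q. \<forall>t. peval (($) (inv \<phi> (\<gamma> t))) f = poly Q t"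
proof -
  have "\<exists>Q. \<forall>t. inv \<phi> (\<gamma> t) $ i = poly Q t" for i
  proof -
    have "Vector_Spaces.linear scale (*) (\<lambda>a. inv \<phi> a $ i)"
    proof
      fix a a' c
      have add: "inv \<phi> (\<phi> x + \<phi> y) = x + y" for x y by (metis \<phi>.add \<phi>_inv(2))
      have scale: "inv \<phi> (scale c (\<phi> x)) = c *s x" for x by (metis \<phi>.scale \<phi>_inv(2))
      show "inv \<phi> (a + a') $ i = inv \<phi> a $ i + inv \<phi> a' $ i"
        "inv \<phi> (scale c a) $ i = c * inv \<phi> a $ i"
        by (metis add \<phi>_inv(1) vector_add_component)
           (metis scale \<phi>_inv(1) vector_smult_component)
    qed
    then show ?thesis using assms unfolding poly_curve_def by blast
  qed
  then obtain q where "\<And>i t. inv \<phi> (\<gamma> t) $ i = poly (q i) t" by metis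
  then show ?thesis by (rule peval_along_poly_curve)
qed

lemma polyfun_F: "polyfun UNIV (\<lambda>x. F (\<phi> x))"
  unfolding F_def
proof (intro polyfun_sum polyfun_mult[where D=UNIV and E=UNIV] polyfun_const polyfun_power)
  show "polyfun UNIV (\<lambda>x. \<epsilon> (\<phi> x))"
    using polyfun_functional_power[OF \<phi>_linear \<epsilon> scale_mult, of 1] polyfun_mono by auto
  have "Vector_Spaces.linear (*s) scale (\<lambda>x. \<phi> x - scale (\<epsilon> (\<phi> x)) 1)"
    by unfold_locales
       (simp_all add: \<phi>.add \<phi>.scale \<epsilon>.add \<epsilon>.scale scale_left_distrib scale_right_diff_distrib)
  from polyfun_functional_power[OF this \<pi> scale_mult]
  show "polyfun UNIV (\<lambda>x. \<pi> ((\<phi> x - scale (\<epsilon> (\<phi> x)) 1) ^ k))" for k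
    by (rule polyfun_mono[OF _ subset_UNIV])
qed auto

lemma pt_in_X_iff_line: "pt x \<in> X \<longleftrightarrow> line scale (\<phi> x) \<in> image \<phi> ` X"
  using \<phi>_image_inj by (auto simp flip: \<phi>_pt)

section \<open>Points of X inside and outside the exponential cone\<close>

lemma exp_cone_in_X:
  assumes "c \<noteq> 0" "u \<in> U" "\<phi> x = scale c (nilp_exp scale u)"
  shows "pt x \<in> X"
proof -
  have x: "x \<in> affine_closure (\<phi> -` exp_cone scale U)"
    using assms by (auto simp: affine_closure_def exp_cone_def)
  have "\<epsilon> (\<phi> x) \<noteq> 0" using assms by (simp add: \<epsilon>.scale \<epsilon>_exp mem_U_iff)
  then have "\<phi> x \<noteq> 0" by auto
  then have "line scale (\<phi> x) \<in> image \<phi> ` X"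
    using corr x by (auto simp: corresponds_def proj_space_def)
  then show ?thesis by (simp add: pt_in_X_iff_line)
qed

lemma F_vanishes_on_X:
  assumes "pt x \<in> X" "x \<noteq> 0"
  shows "F (\<phi> x) = 0"
proof -
  obtain f where f: "\<And>x. F (\<phi> x) = peval (($) x) f" using polyfun_F unfolding polyfun_def by blast
  have "line scale (\<phi> x) \<in> proj_space scale (\<phi> ` affine_closure (\<phi> -` exp_cone scale U))"
    using assms(1) corr by (simp add: pt_in_X_iff_line corresponds_def)
  then obtain y where y: "y \<in> affine_closure (\<phi> -` exp_cone scale U)" "\<phi> y \<noteq> 0"
      "line scale (\<phi> x) = line scale (\<phi> y)"
    by (auto simp: proj_space_def)
  \<comment> \<open>The point of the closure that \<open>proj_space\<close> supplies may be another
    representative; \<open>F_scale\<close> absorbs the factor.\<close>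
  obtain c where c: "\<phi> x = scale c (\<phi> y)"
    using y line_eq_iff[OF vector_space_axioms] assms(2) \<phi>_eq_0_iff by metis
  have "F (\<phi> z) = 0" if "z \<in> \<phi> -` exp_cone scale U" for z
    using that F_exp by (auto simp: exp_cone_def mem_U_iff)
  then have "F (\<phi> y) = 0" using y(1) unfolding affine_closure_def f by blast
  then show ?thesis unfolding c by (rule F_scale)
qed

lemma pt_in_X_iff_on_m:
  assumes "x \<noteq> 0" "\<phi> x \<in> \<mm>"
  shows "pt x \<in> X \<longleftrightarrow> \<pi> (\<phi> x ^ d) = 0"
proof -
  obtain f where f: "\<And>x. F (\<phi> x) = peval (($) x) f" using polyfun_F unfolding polyfun_def by blast
  have "f \<in> vanishing_ideal X"
    using F_vanishes_on_X by (auto simp: vanishing_ideal_def simp flip: f)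
  then obtain h where h: "f = g * h" using ideal_X by blast
  have "peval (($) (inv \<phi> (\<phi> x))) g = 0 \<longleftrightarrow> \<pi> (\<phi> x ^ d) = 0"
  proof (rule F_factor_on_m[OF _ peval_poly_curve peval_poly_curve _ assms(2)])
    show "F a = peval (($) (inv \<phi> a)) g * peval (($) (inv \<phi> a)) h" for a
      using f[of "inv \<phi> a"] by (simp add: \<phi>_inv h peval_mult)
    fix c :: 'k and u assume cu: "c \<noteq> 0" "u \<in> U"
    let ?x = "inv \<phi> (scale c (nilp_exp scale u))"
    have "\<epsilon> (\<phi> ?x) \<noteq> 0" using cu by (simp add: \<phi>_inv \<epsilon>.scale \<epsilon>_exp mem_U_iff)
    then have "?x \<noteq> 0" by (metis \<phi>.zero \<epsilon>.zero)
    then show "peval (($) ?x) g = 0"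
      using exp_cone_in_X[OF cu \<phi>_inv(1)] pt_in_hypersurface_iff[OF g] by blast
  qed
  then show ?thesis using pt_in_hypersurface_iff[OF g assms(1)] by (simp add: \<phi>_inv)
qed

lemma X_pointE:
  assumes "L \<in> X"
  obtains x where "x \<noteq> 0" "L = pt x"
  using assms g unfolding hypersurface_eq_def by (metis zero_locusE)

text \<open>\<open>open_orbit\<close> does not tell where the base point lies. In
  \<open>\<mm>\<close>, an ideal, it would keep the whole orbit there, and X would be the union of
  two proper closed subsets, X - orb and its part in \<open>\<mm>\<close>. So the base point is a
  multiple of some exp u0 with u0 in U, and translation by U reaches all of exp U.\<close>

lemma pt_in_open_orbit_iff:
  assumes act: "additive_action X \<alpha>" and orb: "open_orbit X \<alpha> orb"
    and x: "x \<noteq> 0" "pt x \<in> X"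
  shows "pt x \<in> orb \<longleftrightarrow> \<phi> x \<notin> \<mm>"
proof -
  obtain L where L: "L \<in> X" "orb = range (\<lambda>s. \<alpha> s L)" and closed: "zariski_closed (X - orb)"
    using orb by (auto simp: open_orbit_def)
  have stays: "\<alpha> s L \<in> X" and \<alpha>0: "\<alpha> 0 L = L" for s
    using act L by (auto simp: additive_action_def regular_action_def)
  obtain x0 where x0: "x0 \<noteq> 0" "L = pt x0" using L(1) by (rule X_pointE)
  obtain \<theta> where \<theta>: "range \<theta> = U"
      "\<And>t x. x \<noteq> 0 \<Longrightarrow> pt x \<in> X \<Longrightarrow> \<phi> ` \<alpha> t (pt x) = line scale (nilp_exp scale (\<theta> t) * \<phi> x)"
    using corr by (auto simp: corresponds_def)
  have \<alpha>_pt: "\<exists>c. c \<noteq> 0 \<and> \<phi> y = scale c (nilp_exp scale (\<theta> t) * \<phi> x0)"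
    if "y \<noteq> 0" "\<alpha> t L = pt y" for t y
  proof -
    have "line scale (\<phi> y) = \<phi> ` \<alpha> t L" by (simp only: \<phi>_pt that(2))
    also have "\<dots> = line scale (nilp_exp scale (\<theta> t) * \<phi> x0)"
      using \<theta>(2)[OF x0(1)] L(1) unfolding x0(2) by blast
    finally have "\<phi> y \<in> line scale (nilp_exp scale (\<theta> t) * \<phi> x0)"
      using self_in_line[OF vector_space_axioms] by metis
    moreover have "\<phi> y \<noteq> 0" using that \<phi>_eq_0_iff by blast
    ultimately show ?thesis unfolding line_def by fastforce
  qed
  have "\<phi> x0 \<notin> \<mm>"
  proof
    assume m: "\<phi> x0 \<in> \<mm>"
    obtain p where p: "homogeneous 1 p" "\<And>x. \<epsilon> (\<phi> x) = peval (($) x) p"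
      using polyfun_functional_power[OF \<phi>_linear \<epsilon> scale_mult, of 1]
      unfolding power_one_right by (rule polyfun_homogeneousE) blast
    \<comment> \<open>The part of X in \<open>\<mm>\<close>: the linear form p is the residue map in
      coordinates.\<close>
    define Z where "Z = zero_locus {g, p}"
    have hom: "\<exists>d. homogeneous d f" if "f \<in> {g, p}" for f
      using that g p(1) unfolding hypersurface_eq_def by blast
    have Z: "pt y \<in> Z \<longleftrightarrow> pt y \<in> X \<and> \<phi> y \<in> \<mm>" if "y \<noteq> 0" for y
      using pt_in_zero_locus_iff[of "{g, p}", OF hom that] pt_in_hypersurface_iff[OF g that]
      by (auto simp: Z_def mem_m_iff p(2))
    have "X = (X - orb) \<union> Z"
    proof (intro equalityI subsetI)
      fix M assume M: "M \<in> X"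
      show "M \<in> (X - orb) \<union> Z"
      proof (cases "M \<in> orb")
        case True
        obtain y where y: "y \<noteq> 0" "M = pt y" using M by (rule X_pointE)
        from True obtain t where "\<alpha> t L = pt y" using L(2) y(2) by auto
        then obtain c where "\<phi> y = scale c (nilp_exp scale (\<theta> t) * \<phi> x0)" using \<alpha>_pt y(1) by blast
        then have "\<phi> y \<in> \<mm>" using m by (simp add: m_ideal m_scale)
        then show ?thesis using Z y M by blast
      qed (use M in blast)
    next
      fix M assume "M \<in> (X - orb) \<union> Z"
      then show "M \<in> X" using Z zero_locusE[of M "{g, p}"] unfolding Z_def by blast
    qed
    moreover have "zariski_closed Z" unfolding zariski_closed_def Z_def using hom by blast
    ultimately have "X = X - orb \<or> X = Z"
      using act closed unfolding additive_action_def irreducible_closed_def by blast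
    moreover have "L \<in> orb" using L(2) \<alpha>0 by (metis rangeI)
    moreover have "X \<noteq> Z"
    proof -
      \<comment> \<open>The class of 1 = exp 0 belongs to X and lies outside
        \<open>\<mm>\<close>.\<close>
      let ?y = "inv \<phi> (nilp_exp scale 0)"
      have "0 \<in> U" by (simp add: mem_U_iff m_0)
      then have "pt ?y \<in> X" using exp_cone_in_X[of 1 0 ?y] by (simp add: \<phi>_inv)
      moreover have nm: "\<phi> ?y \<notin> \<mm>" by (simp add: \<phi>_inv mem_m_iff \<epsilon>_exp m_0)
      moreover from nm have "?y \<noteq> 0" using m_0 by (metis \<phi>.zero)
      ultimately show ?thesis using Z by blast
    qed
    ultimately show False using L(1) by blast
  qed
  moreover have "F (\<phi> x0) = 0" using F_vanishes_on_X x0 L(1) by blast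
  ultimately obtain c0 u0 where u0: "c0 \<noteq> 0" "u0 \<in> U" "\<phi> x0 = scale c0 (nilp_exp scale u0)"
    using F_eq_0_imp_in_exp_cone by blast
  have U_add: "u + u' \<in> U" "u - u' \<in> U" if "u \<in> U" "u' \<in> U" for u u'
    using that by (simp_all add: mem_U_iff m_add m_diff \<pi>.add \<pi>.diff)
  have exp_add: "nilp_exp scale u * \<phi> x0 = scale c0 (nilp_exp scale (u + u0))" if "u \<in> U" for u
  proof -
    have "nilp_exp scale (u + u0) = nilp_exp scale u * nilp_exp scale u0"
      using that u0(2) U_add(1)[OF that u0(2)]
      by (intro nilp_exp_add[of _ N] m_nilpotent) (auto simp: mem_U_iff)
    then show ?thesis by (simp add: u0(3) mult_scale)
  qed
  show ?thesis
  proof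
    assume "pt x \<in> orb"
    then obtain t where "\<alpha> t L = pt x" using L(2) by auto
    then obtain c where "c \<noteq> 0" "\<phi> x = scale c (nilp_exp scale (\<theta> t) * \<phi> x0)"
      using \<alpha>_pt x(1) by blast
    moreover have "\<theta> t \<in> U" using \<theta>(1) by blast
    moreover have "\<epsilon> (nilp_exp scale (\<theta> t + u0)) = 1"
      using U_add(1)[OF \<open>\<theta> t \<in> U\<close> u0(2)] by (simp add: \<epsilon>_exp mem_U_iff)
    ultimately show "\<phi> x \<notin> \<mm>" using u0(1) by (simp add: exp_add mem_m_iff \<epsilon>.scale)
  next
    assume "\<phi> x \<notin> \<mm>"
    then obtain c u where u: "c \<noteq> 0" "u \<in> U" "\<phi> x = scale c (nilp_exp scale u)"
      using F_vanishes_on_X[OF x(2,1)] F_eq_0_imp_in_exp_cone by blast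
    obtain t where t: "\<theta> t = u - u0" using U_add(2)[OF u(2) u0(2)] \<theta>(1) by (metis imageE)
    have "\<phi> ` \<alpha> t L = line scale (scale c0 (nilp_exp scale u))"
      using \<theta>(2)[OF x0(1), of t] L(1) x0(2) exp_add[OF U_add(2)[OF u(2) u0(2)]] t by simp
    also have "\<dots> = line scale (\<phi> x)"
    proof -
      have "\<phi> x \<noteq> 0" using x(1) \<phi>_eq_0_iff by blast
      moreover have "scale c0 (nilp_exp scale u) = scale (c0 / c) (\<phi> x)" "c0 / c \<noteq> 0"
        using u(1,3) u0(1) by simp_all
      moreover from this have "scale c0 (nilp_exp scale u) \<noteq> 0" using \<open>\<phi> x \<noteq> 0\<close> by simp
      ultimately show ?thesis using line_eq_iff[OF vector_space_axioms] by blast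
    qed
    finally have "\<alpha> t L = pt x" using \<phi>_image_inj \<phi>_pt by metis
    then show "pt x \<in> orb" using L(2) by (metis rangeI)
  qed
qed

section \<open>The boundary as a hypersurface in the projective space of
  \<open>\<mm>\<close>\<close>

lemma boundary_eq:
  assumes "additive_action X \<alpha>" "open_orbit X \<alpha> orb"
  shows "X - orb = {pt x |x. x \<noteq> 0 \<and> \<phi> x \<in> \<mm> \<and> \<pi> (\<phi> x ^ d) = 0}"
proof (intro equalityI subsetI)
  fix L assume L: "L \<in> X - orb"
  then obtain x where x: "x \<noteq> 0" "L = pt x" by (blast elim: X_pointE)
  then have "\<phi> x \<in> \<mm>" using L pt_in_open_orbit_iff[OF assms] by blast
  then show "L \<in> {pt x |x. x \<noteq> 0 \<and> \<phi> x \<in> \<mm> \<and> \<pi> (\<phi> x ^ d) = 0}"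
    using x L pt_in_X_iff_on_m by blast
next
  fix L assume "L \<in> {pt x |x. x \<noteq> 0 \<and> \<phi> x \<in> \<mm> \<and> \<pi> (\<phi> x ^ d) = 0}"
  then show "L \<in> X - orb" using pt_in_X_iff_on_m pt_in_open_orbit_iff[OF assms] by blast
qed

lemma boundary_degenerate:
  fixes \<psi> :: "'k ^ 'm::finite \<Rightarrow> 'a"
  assumes "additive_action X \<alpha>" "open_orbit X \<alpha> orb"
    and \<psi>: "Vector_Spaces.linear (*s) scale \<psi>" "inj \<psi>" "range \<psi> = \<mm>"
  defines "Y \<equiv> {L \<in> projective_space. \<psi> ` L \<in> image \<phi> ` (X - orb)}"
  shows "image \<phi> ` (X - orb) \<subseteq> proj_space scale \<mm> \<and>
         degenerate_hypersurface Y \<and> (singular_hypersurface Y \<or> hyperplane Y)"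
proof
  note bd = boundary_eq[OF assms(1,2)]
  show "image \<phi> ` (X - orb) \<subseteq> proj_space scale \<mm>"
  proof
    fix M assume "M \<in> image \<phi> ` (X - orb)"
    then obtain x where "x \<noteq> 0" "\<phi> x \<in> \<mm>" "M = line scale (\<phi> x)"
      unfolding bd using \<phi>_pt by blast
    then show "M \<in> proj_space scale \<mm>" using \<phi>_eq_0_iff unfolding proj_space_def by blast
  qed
  interpret \<psi>: Vector_Spaces.linear "(*s)" scale \<psi> by fact
  have \<psi>_0: "\<psi> y = 0 \<longleftrightarrow> y = 0" for y using \<psi>(2) by (metis \<psi>.zero injD)
  obtain G where G: "homogeneous d G" "\<And>y. \<pi> (\<psi> y ^ d) = peval (($) y) G"
    using polyfun_functional_power[OF \<psi>(1) \<pi> scale_mult] by (rule polyfun_homogeneousE) blast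
  have "pt y \<in> Y \<longleftrightarrow> \<pi> (\<psi> y ^ d) = 0" if y: "y \<noteq> 0" for y
  proof -
    have "\<psi> y \<noteq> 0" "\<psi> y \<in> \<mm>" using y \<psi>_0 \<psi>(3) by blast+
    have "pt y \<in> Y \<longleftrightarrow> line scale (\<psi> y) \<in> image \<phi> ` (X - orb)"
      using y by (auto simp: Y_def projective_space_eq pt_def image_line[OF \<psi>(1)])
    also have "\<dots> \<longleftrightarrow> pt (inv \<phi> (\<psi> y)) \<in> X - orb"
    proof -
      have "line scale (\<psi> y) = \<phi> ` pt (inv \<phi> (\<psi> y))" by (simp add: \<phi>_pt \<phi>_inv)
      moreover have "inj (image \<phi>)" by (rule injI) (rule \<phi>_image_inj)
      ultimately show ?thesis by (simp only: inj_image_mem_iff)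
    qed
    also have "\<dots> \<longleftrightarrow> \<pi> (\<psi> y ^ d) = 0"
    proof -
      have "inv \<phi> (\<psi> y) \<noteq> 0" using \<open>\<psi> y \<noteq> 0\<close> by (metis \<phi>.zero \<phi>_inv(1))
      then show ?thesis
        using pt_in_X_iff_on_m[of "inv \<phi> (\<psi> y)"] pt_in_open_orbit_iff[OF assms(1,2), of "inv \<phi> (\<psi> y)"]
          \<open>\<psi> y \<in> \<mm>\<close> by (auto simp: \<phi>_inv)
    qed
    finally show ?thesis .
  qed
  then have "Y = zero_locus {G}"
    unfolding zero_locus_def by (auto simp: Y_def projective_space_eq simp flip: G(2))
  moreover have "G \<noteq> 0"
  proof
    assume "G = 0"
    \<comment> \<open>G is not the zero polynomial because its value at the preimage of b is
      nonzero.\<close>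
    obtain y where "\<psi> y = b" using b(1) \<psi>(3) by blast
    then show False using G(2)[of y] b(2) \<open>G = 0\<close> by simp
  qed
  ultimately have hyp: "hypersurface_eq G Y"
    unfolding hypersurface_eq_def using G(1) d_ge_2 by (intro conjI exI[of _ d]) auto
  obtain w where w: "w \<in> \<mm>" "w \<noteq> 0" "\<And>z t. z \<in> \<mm> \<Longrightarrow> \<pi> ((z + scale t w) ^ d) = \<pi> (z ^ d)"
    using vertex by blast
  obtain w' where w': "\<psi> w' = w" using w(1) \<psi>(3) by blast
  show "degenerate_hypersurface Y \<and> (singular_hypersurface Y \<or> hyperplane Y)"
  proof (rule hypersurface_with_vertex[OF hyp G(1)])
    show "w' \<noteq> 0" using w(2) w' by auto
    show "peval (($) (x + t *s w')) G = peval (($) x) G" for x t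
      using w(3)[of "\<psi> x" t] \<psi>(3) by (auto simp: \<psi>.add \<psi>.scale w' simp flip: G(2))
  qed (use d_ge_2 in simp)
qed

end

theorem proposition4:
  fixes scale :: "'k::{alg_closed_field, field_char_0} \<Rightarrow> 'a::comm_ring_1 \<Rightarrow> 'a"
    and \<mm> U :: "'a set"
    and n d :: nat
    and X X\<^sub>0 orb :: "('k ^ 'n::finite) set set"
    and \<alpha> :: "'k ^ 'g::finite \<Rightarrow> ('k ^ 'n) set \<Rightarrow> ('k ^ 'n) set"
    and \<phi> :: "'k ^ 'n \<Rightarrow> 'a"
    and \<psi> :: "'k ^ 'm::finite \<Rightarrow> 'a"
  assumes "CARD('n) = n + 1" and "CARD('m) = n" and "CARD('g) = n - 1"
    and "hypersurface_of_degree d X" and "d \<ge> 2"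
    and "induced_additive_action X \<alpha>"
    and "H_pair scale \<mm> U"
    and "corresponds scale U \<phi> X \<alpha>"
    and "open_orbit X \<alpha> orb" and "X\<^sub>0 = X - orb"
    \<comment> \<open>\<open>\<psi>\<close> is an arbitrary choice of the identification of \<open>\<bbbP>\<^sup>n\<^sup>-\<^sup>1\<close> with \<open>\<bbbP>(\<mm>)\<close>\<close>
    and "Vector_Spaces.linear (*s) scale \<psi>" and "inj \<psi>" and "range \<psi> = \<mm>"
  defines "Y \<equiv> {L \<in> projective_space. \<psi> ` L \<in> image \<phi> ` X\<^sub>0}"
  shows "image \<phi> ` X\<^sub>0 \<subseteq> proj_space scale \<mm> \<and>
         degenerate_hypersurface Y \<and>
         (singular_hypersurface Y \<or> hyperplane Y)"
proof -
  have alg: "fin_dim_algebra scale"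
    using assms(7) by (simp add: H_pair_def local_algebra_def)
  then have vs: "vector_space scale" by (simp add: fin_dim_algebra_def)
  then interpret vector_space scale .
  obtain S where S: "finite S" "span S = UNIV" using alg by (auto simp: fin_dim_algebra_def)
  obtain B where B: "B \<subseteq> S" "independent B" "S \<subseteq> span B"
    by (rule maximal_independent_subset[of S]) (rule that)
  have "span B = UNIV" using span_minimal[OF B(3) subspace_span] S(2) by auto
  moreover have "finite B" using B(1) S(1) by (rule finite_subset)
  ultimately interpret fin_dim_comm_algebra scale B
    using alg B(2) by unfold_locales (auto simp: fin_dim_algebra_def)
  \<comment> \<open>The two identifications give the dimensions of the algebra and of
    \<open>\<mm>\<close>, hence codimension one: the residue field is the base field.\<close>
  have "bij \<phi>" "Vector_Spaces.linear (*s) scale \<phi>"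
    using assms(8) by (auto simp: corresponds_def)
  then have "dim UNIV = CARD('n)"
    using dim_range_injective_linear[of scale \<phi>] by (simp add: bij_is_inj bij_is_surj)
  moreover have "dim \<mm> = CARD('m)"
    using dim_range_injective_linear[of scale \<psi>] assms(11-13) by simp
  \<comment> \<open>The exponent of the locale is called \<open>e\<close> here, to keep it apart
    from the degree \<open>d\<close> of the statement.\<close>
  ultimately obtain \<pi> \<epsilon> N e v b where "H_pair_coordinates scale \<mm> U \<pi> \<epsilon> N e v b"
    using exists_H_pair_coordinates[OF fin_dim_comm_algebra_axioms assms(7)] assms(1,2) by auto
  then interpret H_pair_coordinates scale \<mm> U \<pi> \<epsilon> N e v b .
  obtain g where "hypersurface_eq g X" "vanishing_ideal X = range ((*) g)"
    using assms(4) by (auto simp: hypersurface_of_degree_def)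
  then interpret H_pair_hypersurface scale \<mm> U \<pi> \<epsilon> N e v b \<phi> X \<alpha> g
    using assms(8) by unfold_locales
  have "additive_action X \<alpha>" using assms(6) by (simp add: induced_additive_action_def)
  from boundary_degenerate[OF this assms(9,11-13)] show ?thesis
    unfolding Y_def assms(10) .
qed

end
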